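(* Assume $\gamma_i>0$ for all $1\le i\le k$ and $\#\widetilde{\mathcal A}_k\ge2$. With probability 1, conditional on $K\neq\emptyset$, the Hausdorff dimension of $K$ in $(X_1,d_{\vec\gamma})$ satisfies $$\dim_HK\le\inf\{P_i(\theta):\ 2\le i\le k,\ \widetilde\theta_i\le\theta\le1\}.$$
   Context: Symbolic setting. Let $k\ge2$. For $1\le i\le k$ let $\mathcal A_i$ be a finite alphabet with at least 2 elements, $X_i=\mathcal A_i^{\{1,2,\dots\}}$ and $T_i$ the left shift on $X_i$. For $1\le i\le k-1$ let $\pi_i:\mathcal A_i\to\mathcal A_{i+1}$ be a surjective map, extended letter by letter to finite words and to $X_i$. Set $\Pi_i=\pi_{i-1}\circ\cdots\circ\pi_1$ ($\Pi_1$ the identity), and $\Pi_{i,j}=\pi_{j-1}\circ\cdots\circ\pi_i$ for $j>i$, $\Pi_{i,i}$ the identity. $f\nu$ denotes the push-forward of $\nu$ by $f$. $\mathcal A_1^*$ is the set of finite words over $\mathcal A_1$ (including the empty word), $x_{|n}$ the prefix of length $n$, $|x\wedge y|$ the length of the longest common prefix. $\vec\gamma=(\gamma_1,\dots,\gamma_k)$ has positive entries. $X_1$ is endowed with $d_{\vec\gamma}(x,y)=\max_{1\le i\le k}\exp(-|\Pi_i(x)\wedge\Pi_i(y)|/(\gamma_1+\cdots+\gamma_i))$. Random sponge. Let $A=(c_a)_{a\in\mathcal A_1}$ be a random element of $\{0,1\}^{\mathcal A_1}$, identified with $\{a:c_a=1\}$, with $\mathbb E(\#A)>1$. Let $(A(u))_{u\in\mathcal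 A_1^*}$, $A(u)=(c_a(u))_a$, be independent copies of $A$, $K_n=\{x\in X_1:c_{x_j}(x_{|j-1})=1,\ 1\le j\le n\}$, $K=\bigcap_{n\ge1}K_n$. Pressures. For $1\le i\le k$, $b\in\mathcal A_i$: $N_b^{(i)}=\#\{a\in A:\Pi_i(a)=b\}$; $\widetilde{\mathcal A}_i=\{b\in\mathcal A_i:\mathbb E(N^{(i)}_b)>0\}$; $\widetilde X_i$ is the one-sided full shift space over $\widetilde{\mathcal A}_i$, and $\mathcal M(\widetilde X_i,T_i)$ the set of shift-invariant Borel probability measures on it; $h_\nu(T_i)$ is measure-theoretic entropy. For $2\le i\le k$ and $\theta\in\mathbb R$, $$P_i(\theta)=\sup_{\nu\in\mathcal M(\widetilde X_i,T_i)}\Big\{\theta\int\phi_i\,d\nu+(\gamma_1+\cdots+\gamma_i)h_\nu(T_i)+\sum_{j=i+1}^k\gamma_jh_{\Pi_{i,j}\nu}(T_j)\Big\},\quad\phi_i(x)=(\gamma_1+\cdots+\gamma_i)\log\mathbb E(N^{(i)}_{x_1}),$$ and $\widetilde\theta_i=\dfrac{\gamma_1+\cdots+\gamma_{i-1}}{\gamma_1+\cdots+\gamma_i}$. *)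

theory Defs
  imports "HOL-Probability.Probability"
begin

section \<open>Hausdorff dimension of a subset of a metric space \<open>(X, d)\<close>\<close>

definition set_diam :: "('x \<Rightarrow> 'x \<Rightarrow> real) \<Rightarrow> 'x set \<Rightarrow> ennreal" where
  "set_diam d U = (SUP x\<in>U. SUP y\<in>U. ennreal (d x y))"

text \<open>The usual conventions for exponent 0 are made explicit, since \<open>0 powr 0 = 0\<close>.
  The conversion to a real is only used for sets of finite diameter.\<close>

definition diam_power :: "('x \<Rightarrow> 'x \<Rightarrow> real) \<Rightarrow> real \<Rightarrow> 'x set \<Rightarrow> ennreal" where
  "diam_power d s U =
     (if U = {} then 0 else if s = 0 then 1 else ennreal (enn2real (set_diam d U) powr s))"

definition hausdorff_pre ::
  "'x set \<Rightarrow> ('x \<Rightarrow> 'x \<Rightarrow> real) \<Rightarrow> real \<Rightarrow> real \<Rightarrow> 'x set \<Rightarrow> ennreal" where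
  "hausdorff_pre X d s \<delta> E =
     (INF U \<in> {U :: nat \<Rightarrow> 'x set.
                (\<forall>n. U n \<subseteq> X \<and> set_diam d (U n) \<le> ennreal \<delta>) \<and> E \<subseteq> (\<Union>n. U n)}.
        \<Sum>n. diam_power d s (U n))"

definition hausdorff_measure ::
  "'x set \<Rightarrow> ('x \<Rightarrow> 'x \<Rightarrow> real) \<Rightarrow> real \<Rightarrow> 'x set \<Rightarrow> ennreal" where
  "hausdorff_measure X d s E = (SUP \<delta>\<in>{0<..}. hausdorff_pre X d s \<delta> E)"

definition hausdorff_dim :: "'x set \<Rightarrow> ('x \<Rightarrow> 'x \<Rightarrow> real) \<Rightarrow> 'x set \<Rightarrow> ereal" where
  "hausdorff_dim X d E = (INF s\<in>{s. 0 \<le> s \<and> hausdorff_measure X d s E = 0}. ereal s)"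


section \<open>Kolmogorov--Sinai entropy\<close>

definition finite_partition :: "'x measure \<Rightarrow> 'x set set \<Rightarrow> bool" where
  "finite_partition M P \<longleftrightarrow> finite P \<and> P \<subseteq> sets M \<and> partition_on (space M) P"

definition partition_entropy :: "'x measure \<Rightarrow> 'x set set \<Rightarrow> real" where
  "partition_entropy M P = - (\<Sum>C\<in>P. measure M C * ln (measure M C))"

text \<open>The join of the partitions \<open>T\<^sup>-\<^sup>iP\<close> for \<open>i < n\<close>.\<close>

definition iterated_join :: "'x measure \<Rightarrow> ('x \<Rightarrow> 'x) \<Rightarrow> 'x set set \<Rightarrow> nat \<Rightarrow> 'x set set" where
  "iterated_join M T P n =
     {C. C \<noteq> {} \<and> (\<exists>f\<in>{..<n} \<rightarrow> P. C = {x \<in> space M. \<forall>i<n. (T ^^ i) x \<in> f i})}"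

definition ks_entropy :: "'x measure \<Rightarrow> ('x \<Rightarrow> 'x) \<Rightarrow> ereal" where
  "ks_entropy M T =
     (SUP P\<in>{P. finite_partition M P}.
        ereal (lim (\<lambda>n. partition_entropy M (iterated_join M T P n) / real n)))"


section \<open>Symbolic spaces\<close>

text \<open>The points of the one-sided full shift over a finite alphabet \<open>S\<close> are the functions
  \<open>x :: nat \<Rightarrow> 'a\<close> with values in \<open>S\<close>; the letter \<open>x\<^sub>j\<close> with \<open>j = 1, 2, \<dots>\<close> is \<open>x (j - 1)\<close>.
  As \<open>S\<close> is finite, the product sigma-algebra is the Borel sigma-algebra of the product topology.

  All alphabets \<open>Al 1, \<dots>, Al k\<close> are finite subsets of one type \<open>'a\<close>, and \<open>p i\<close> is the factor
  map from \<open>Al i\<close> to \<open>Al (i + 1)\<close>.\<close>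

definition shift_space :: "'a set \<Rightarrow> (nat \<Rightarrow> 'a) measure" where
  "shift_space S = PiM UNIV (\<lambda>_. count_space S)"

definition shift :: "(nat \<Rightarrow> 'a) \<Rightarrow> nat \<Rightarrow> 'a" where
  "shift x = (\<lambda>n. x (Suc n))"

definition invariant_measures :: "'a set \<Rightarrow> (nat \<Rightarrow> 'a) measure set" where
  "invariant_measures S =
     {\<nu>. prob_space \<nu> \<and> sets \<nu> = sets (shift_space S) \<and> distr \<nu> (shift_space S) shift = \<nu>}"

text \<open>\<open>proj p i j\<close> is \<open>p (j - 1) \<circ> \<dots> \<circ> p i\<close> on letters, and the identity for \<open>j = i\<close>.\<close>

definition proj :: "(nat \<Rightarrow> 'a \<Rightarrow> 'a) \<Rightarrow> nat \<Rightarrow> nat \<Rightarrow> 'a \<Rightarrow> 'a" where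
  "proj p i j a = fold p [i..<j] a"

definition proj_seq :: "(nat \<Rightarrow> 'a \<Rightarrow> 'a) \<Rightarrow> nat \<Rightarrow> nat \<Rightarrow> (nat \<Rightarrow> 'a) \<Rightarrow> nat \<Rightarrow> 'a" where
  "proj_seq p i j x = (\<lambda>n. proj p i j (x n))"

definition gsum :: "(nat \<Rightarrow> real) \<Rightarrow> nat \<Rightarrow> real" where
  "gsum \<gamma> i = (\<Sum>j=1..i. \<gamma> j)"

text \<open>For \<open>x \<noteq> y\<close>, the least \<open>n\<close> with \<open>x n \<noteq> y n\<close> is the length of the longest common prefix;
  for \<open>x = y\<close> that length is infinite and the exponential vanishes.\<close>

definition common_prefix :: "(nat \<Rightarrow> 'a) \<Rightarrow> (nat \<Rightarrow> 'a) \<Rightarrow> nat" where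
  "common_prefix x y = (LEAST n. x n \<noteq> y n)"

definition sponge_dist ::
  "(nat \<Rightarrow> 'a \<Rightarrow> 'a) \<Rightarrow> (nat \<Rightarrow> real) \<Rightarrow> nat \<Rightarrow> (nat \<Rightarrow> 'a) \<Rightarrow> (nat \<Rightarrow> 'a) \<Rightarrow> real" where
  "sponge_dist p \<gamma> k x y =
     (MAX i\<in>{1..k}.
        if proj_seq p 1 i x = proj_seq p 1 i y then 0
        else exp (- real (common_prefix (proj_seq p 1 i x) (proj_seq p 1 i y)) / gsum \<gamma> i))"


section \<open>Random sponges\<close>

text \<open>A random element of \<open>{0,1}\<close> to the power \<open>Al 1\<close> is treated as a random subset of \<open>Al 1\<close>;
  a family of them is indexed by finite words.\<close>

definition sponge_level ::
  "'a set \<Rightarrow> ('a list \<Rightarrow> 'w \<Rightarrow> 'a set) \<Rightarrow> nat \<Rightarrow> 'w \<Rightarrow> (nat \<Rightarrow> 'a) set" where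
  "sponge_level S A n \<omega> =
     {x \<in> space (shift_space S). \<forall>j<n. x j \<in> A (map x [0..<j]) \<omega>}"

definition sponge ::
  "'a set \<Rightarrow> ('a list \<Rightarrow> 'w \<Rightarrow> 'a set) \<Rightarrow> 'w \<Rightarrow> (nat \<Rightarrow> 'a) set" where
  "sponge S A \<omega> = (\<Inter>n\<in>{1..}. sponge_level S A n \<omega>)"


section \<open>Pressures\<close>

definition exp_count ::
  "(nat \<Rightarrow> 'a \<Rightarrow> 'a) \<Rightarrow> 'w measure \<Rightarrow> ('w \<Rightarrow> 'a set) \<Rightarrow> nat \<Rightarrow> 'a \<Rightarrow> real" where
  "exp_count p \<Omega> A0 i b = (\<integral>\<omega>. real (card {a \<in> A0 \<omega>. proj p 1 i a = b}) \<partial>\<Omega>)"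

definition reduced_alphabet ::
  "(nat \<Rightarrow> 'a set) \<Rightarrow> (nat \<Rightarrow> 'a \<Rightarrow> 'a) \<Rightarrow> 'w measure \<Rightarrow> ('w \<Rightarrow> 'a set) \<Rightarrow> nat \<Rightarrow> 'a set" where
  "reduced_alphabet Al p \<Omega> A0 i = {b \<in> Al i. exp_count p \<Omega> A0 i b > 0}"

definition potential ::
  "(nat \<Rightarrow> 'a \<Rightarrow> 'a) \<Rightarrow> (nat \<Rightarrow> real) \<Rightarrow> 'w measure \<Rightarrow> ('w \<Rightarrow> 'a set) \<Rightarrow> nat \<Rightarrow> (nat \<Rightarrow> 'a) \<Rightarrow> real"
  where
  "potential p \<gamma> \<Omega> A0 i x = gsum \<gamma> i * ln (exp_count p \<Omega> A0 i (x 0))"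

definition pressure ::
  "(nat \<Rightarrow> 'a set) \<Rightarrow> (nat \<Rightarrow> 'a \<Rightarrow> 'a) \<Rightarrow> (nat \<Rightarrow> real) \<Rightarrow> nat \<Rightarrow> 'w measure \<Rightarrow> ('w \<Rightarrow> 'a set)
     \<Rightarrow> nat \<Rightarrow> real \<Rightarrow> ereal"
  where
  "pressure Al p \<gamma> k \<Omega> A0 i \<theta> =
     (SUP \<nu>\<in>invariant_measures (reduced_alphabet Al p \<Omega> A0 i).
        ereal (\<theta> * (\<integral>x. potential p \<gamma> \<Omega> A0 i x \<partial>\<nu>))
        + ereal (gsum \<gamma> i) * ks_entropy \<nu> shift
        + (\<Sum>j=i+1..k.
             ereal (\<gamma> j) * ks_entropy (distr \<nu> (shift_space (Al j)) (proj_seq p i j)) shift))"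

definition theta_min :: "(nat \<Rightarrow> real) \<Rightarrow> nat \<Rightarrow> real" where
  "theta_min \<gamma> i = gsum \<gamma> (i - 1) / gsum \<gamma> i"

end

theory Submission
  imports Defs
begin

text \<open>
  Fix \<open>i\<close> and \<open>\<theta> = t + (1 - t) * theta_min \<gamma> i\<close> with \<open>0 \<le> t \<le> 1\<close>. The pressure is bounded below by
  its value at the Bernoulli measure \<open>\<nu>\<close> solving the Euler-Lagrange equation of the weighted
  variational problem, so it suffices to bound the dimension by this value \<open>Q\<close>.

  Over a projected ball of radius \<open>exp (- n)\<close> the expected number of balls that meet the sponge is at
  most the expected number of surviving words of length \<open>len n (i - 1)\<close>, and also of length \<open>len n i\<close>, hence
  at most the weighted geometric mean of the two with exponents \<open>1 - t\<close> and \<open>t\<close>. By the Euler-Lagrange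
  equation, this is compared with \<open>exp (n * Q)\<close> times the \<open>\<nu>\<close>-mass of the ball up to the exponential of a
  sum of differences of Birkhoff averages of the same function over lengths proportional to \<open>n\<close>. Such a
  sum cannot stay below \<open>- \<epsilon> * n\<close> for all large \<open>n\<close> (the argument of Kenyon and Peres), so every point of
  the sponge lies in infinitely many balls for which the comparison holds. Counting only these balls and
  summing the masses gives at most \<open>exp (n * (Q + \<epsilon>))\<close> of them in expectation, up to a constant.
\<close>

section \<open>Averages at different scales\<close>

text \<open>Partial sums of a bounded sequence are Lipschitz on the naturals, hence extend to the
  whole line. This allows a length to be dilated by an arbitrary real factor.\<close>

lemma lipschitz_interpolation:
  fixes f :: "nat \<Rightarrow> real"
  assumes f: "\<And>l. \<bar>f l\<bar> \<le> C"
  obtains F :: "real \<Rightarrow> real"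
  where "C-lipschitz_on UNIV F" "\<And>m. F (real m) = (\<Sum>l<m. f l)"
proof -
  have C0: "0 \<le> C" using f[of 0] by linarith
  define S where "S m = (\<Sum>l<m. f l)" for m
  have S_le: "S n - S m \<le> C * (real n - real m)" "S m - S n \<le> C * (real n - real m)" if "m \<le> n" for m n
  proof -
    have "S n - S m = (\<Sum>l\<in>{m..<n}. f l)"
      unfolding S_def using that by (simp add: lessThan_atLeast0 sum_diff_nat_ivl)
    moreover have "\<bar>\<Sum>l\<in>{m..<n}. f l\<bar> \<le> (\<Sum>l\<in>{m..<n}. C)"
      by (rule order_trans[OF sum_abs sum_mono]) (rule f)
    ultimately have "\<bar>S n - S m\<bar> \<le> C * (real n - real m)"
      using that by (simp add: of_nat_diff mult.commute)
    then show "S n - S m \<le> C * (real n - real m)" "S m - S n \<le> C * (real n - real m)" by linarith+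
  qed
  have S_lip: "S n \<le> S m + C * \<bar>real n - real m\<bar>" for m n
    using S_le[of m n] S_le[of n m] by (cases "m \<le> n") auto
  \<comment> \<open>McShane's formula: the largest \<open>C\<close>-Lipschitz extension of
    \<open>S\<close>.\<close>
  define F where "F t = (INF m. S m + C * \<bar>t - real m\<bar>)" for t
  \<comment> \<open>Going through the point 0 bounds all terms from below uniformly in
    \<open>m\<close>, so the infimum over infinitely many \<open>m\<close> is well behaved.\<close>
  have low: "S 0 - C * \<bar>t\<bar> \<le> S m + C * \<bar>t - real m\<bar>" for t m
  proof -
    have "S 0 \<le> S m + C * real m" using S_lip[of 0 m] by simp
    also have "C * real m \<le> C * (\<bar>t\<bar> + \<bar>t - real m\<bar>)" using C0 by (intro mult_left_mono) auto
    finally show ?thesis by (simp add: algebra_simps)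
  qed
  have bdd: "bdd_below (range (\<lambda>m. S m + C * \<bar>t - real m\<bar>))" for t
    by (rule bdd_belowI2[of _ "S 0 - C * \<bar>t\<bar>"]) (rule low)
  have F_le: "F t \<le> F u + C * \<bar>t - u\<bar>" for t u
  proof -
    have "F t - C * \<bar>t - u\<bar> \<le> S m + C * \<bar>u - real m\<bar>" for m
    proof -
      have "F t \<le> S m + C * \<bar>t - real m\<bar>"
        unfolding F_def by (rule cINF_lower[OF bdd]) simp
      also have "C * \<bar>t - real m\<bar> \<le> C * (\<bar>t - u\<bar> + \<bar>u - real m\<bar>)"
        using C0 by (intro mult_left_mono) auto
      finally show ?thesis by (simp add: algebra_simps)
    qed
    then have "F t - C * \<bar>t - u\<bar> \<le> F u"
      unfolding F_def[of u] by (intro cINF_greatest) auto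
    then show ?thesis by simp
  qed
  show thesis
  proof
    show "C-lipschitz_on UNIV F"
    proof (rule lipschitz_onI)
      show "dist (F x) (F y) \<le> C * dist x y" for x y
        using F_le[of x y] F_le[of y x] by (auto simp: dist_real_def abs_minus_commute abs_le_iff)
    qed (rule C0)
    show "F (real m) = (\<Sum>l<m. f l)" for m
    proof (rule antisym)
      show "F (real m) \<le> (\<Sum>l<m. f l)"
        unfolding F_def by (rule cINF_lower2[OF bdd, of m]) (auto simp: S_def)
      show "(\<Sum>l<m. f l) \<le> F (real m)"
        unfolding F_def by (intro cINF_greatest) (use S_lip[of m] in \<open>auto simp: S_def\<close>)
    qed
  qed
qed

text \<open>In the variable \<open>s = ln t\<close> the scaled averages \<open>F r (a r * t) / (a r * t)\<close> become translates
  of one bounded function, and differences of translates have a bounded antiderivative.\<close>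

lemma scaled_averages_real:
  fixes F :: "'r \<Rightarrow> real \<Rightarrow> real"
  assumes lip: "\<And>r. r \<in> R \<Longrightarrow> C-lipschitz_on UNIV (F r)"
    and zero: "\<And>r. r \<in> R \<Longrightarrow> F r 0 = 0"
    and a: "\<And>r. r \<in> R \<Longrightarrow> a r > 0" and b: "b > 0" and \<epsilon>: "\<epsilon> > 0"
  obtains t where "t \<ge> T" "(\<Sum>r\<in>R. F r (a r * t) / a r - F r (b * t) / b) > - \<epsilon> * t"
proof -
  define h where "h r s = F r (exp s) / exp s" for r and s :: real
  have h_le: "\<bar>h r s\<bar> \<le> C" if "r \<in> R" for r s
    using lipschitz_onD[OF lip[OF that], of "exp s" 0] zero[OF that]
    by (simp add: h_def dist_real_def field_simps)
  have "\<exists>H. \<forall>s. (H has_real_derivative h r s) (at s)" if "r \<in> R" for r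
  proof -
    have cont: "continuous_on UNIV (F r)"
      by (rule lipschitz_on_continuous_on[OF lip[OF that]])
    have "isCont (h r) s" for s
      unfolding h_def
      by (intro continuous_divide continuous_at_compose[unfolded o_def, of s exp "F r"])
        (use cont in \<open>auto simp: continuous_on_eq_continuous_at\<close>)
    then have "\<exists>H. \<forall>s::real. -\<infinity> < ereal s \<longrightarrow> ereal s < \<infinity> \<longrightarrow> (H has_vector_derivative h r s) (at s)"
      by (intro einterval_antiderivative) auto
    then show ?thesis
      by (auto simp: has_real_derivative_iff_has_vector_derivative)
  qed
  then obtain H where H: "\<And>r s. r \<in> R \<Longrightarrow> (H r has_real_derivative h r s) (at s)" by metis
  have H_diff: "\<bar>H r x - H r y\<bar> \<le> C * \<bar>x - y\<bar>" if "r \<in> R" for r x y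
    using field_differentiable_bound[of UNIV "H r" "h r" C x y] H[OF that] h_le[OF that] by simp
  define \<Phi> where "\<Phi> s = (\<Sum>r\<in>R. H r (s + ln (a r)) - H r (s + ln b))" for s
  define \<phi> where "\<phi> s = (\<Sum>r\<in>R. h r (s + ln (a r)) - h r (s + ln b))" for s
  \<comment> \<open>Each \<open>H r\<close> is \<open>C\<close>-Lipschitz and its two arguments in
    \<open>\<Phi>\<close> differ by the fixed amount \<open>ln (a r) - ln b\<close>, so this bound
    is uniform in \<open>s\<close>.\<close>
  define B where "B = (\<Sum>r\<in>R. C * \<bar>ln (a r) - ln b\<bar>)"
  have \<Phi>_le: "\<bar>\<Phi> s\<bar> \<le> B" for s
    unfolding \<Phi>_def B_def
    by (rule order_trans[OF sum_abs sum_mono]) (use H_diff[of _ "s + ln (a _)" "s + ln b"] in simp)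
  have \<Phi>: "(\<Phi> has_real_derivative \<phi> s) (at s)" for s
    unfolding \<Phi>_def[abs_def] \<phi>_def
    by (auto intro!: derivative_eq_intros DERIV_chain2[OF H])
  define s0 where "s0 = ln (max T 1)"
  have "\<exists>s\<ge>s0. \<phi> s > - \<epsilon>"
  proof (rule ccontr)
    assume "\<not> ?thesis"
    then have neg: "\<phi> s \<le> - \<epsilon>" if "s \<ge> s0" for s using that by force
    \<comment> \<open>The interval is so long that a derivative of at most
      \<open>- \<epsilon>\<close> would lower \<open>\<Phi>\<close> by \<open>2 * B + 1\<close>,
      more than its total oscillation \<open>2 * B\<close>.\<close>
    define s1 where "s1 = s0 + (2 * B + 1) / \<epsilon>"
    have B0: "0 \<le> B" using \<Phi>_le[of 0] by linarith
    have s01: "s0 < s1" using B0 \<epsilon> by (simp add: s1_def)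
    obtain z where z: "z > s0" "z < s1" "\<Phi> s1 - \<Phi> s0 = (s1 - s0) * \<phi> z"
      using MVT2[OF s01, of \<Phi> \<phi>] \<Phi> by auto
    have "(s1 - s0) * \<phi> z \<le> (s1 - s0) * - \<epsilon>"
      using s01 neg[of z] z by (intro mult_left_mono) auto
    also have "\<dots> = - (2 * B + 1)" using \<epsilon> by (simp add: s1_def)
    finally show False using z(3) \<Phi>_le[of s1] \<Phi>_le[of s0] by linarith
  qed
  then obtain s where s: "s \<ge> s0" "\<phi> s > - \<epsilon>" by blast
  show thesis
  proof
    have "max T 1 = exp s0" by (simp add: s0_def)
    also have "\<dots> \<le> exp s" using s by simp
    finally show "T \<le> exp s" by simp
    have "exp s * \<phi> s > exp s * - \<epsilon>" using s(2) by (intro mult_strict_left_mono) auto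
    also have "exp s * \<phi> s = (\<Sum>r\<in>R. F r (a r * exp s) / a r - F r (b * exp s) / b)"
      unfolding \<phi>_def sum_distrib_left
      using a b by (intro sum.cong) (auto simp: h_def exp_add field_simps)
    finally show "(\<Sum>r\<in>R. F r (a r * exp s) / a r - F r (b * exp s) / b) > - \<epsilon> * exp s"
      by (simp add: mult.commute)
  qed
qed

text \<open>Rounding the real scale \<open>t\<close> up to an integer, and the lengths up to
  integers, moves all arguments by bounded amounts. The resulting bounded error is negligible
  against \<open>\<epsilon> * t\<close> for large \<open>t\<close>.\<close>

lemma scaled_averages:
  fixes f :: "'r \<Rightarrow> nat \<Rightarrow> real"
  assumes f: "\<And>r l. r \<in> R \<Longrightarrow> \<bar>f r l\<bar> \<le> C"
    and a: "\<And>r. r \<in> R \<Longrightarrow> a r > 0" and b: "b > 0" and \<epsilon>: "\<epsilon> > 0"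
  obtains n where "n \<ge> N"
    "(\<Sum>r\<in>R. (\<Sum>l<nat \<lceil>real n * a r\<rceil>. f r l) / a r - (\<Sum>l<nat \<lceil>real n * b\<rceil>. f r l) / b) \<ge> - \<epsilon> * real n"
proof -
  have "\<exists>F. C-lipschitz_on UNIV F \<and> (\<forall>m. F (real m) = (\<Sum>l<m. f r l))" if "r \<in> R" for r
    by (rule lipschitz_interpolation[of "f r" C]) (use f[OF that] in auto)
  then obtain F where lip: "\<And>r. r \<in> R \<Longrightarrow> C-lipschitz_on UNIV (F r)"
    and F: "\<And>r m. r \<in> R \<Longrightarrow> F r (real m) = (\<Sum>l<m. f r l)" by metis
  have zero: "F r 0 = 0" if "r \<in> R" for r using F[OF that, of 0] by simp
  \<comment> \<open>Replacing \<open>t\<close> by \<open>n\<close> moves the argument by at most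
    \<open>c\<close>, and the ceiling by at most 1 more.\<close>
  have near: "\<bar>(\<Sum>l<nat \<lceil>real n * c\<rceil>. f r l) / c - F r (c * t) / c\<bar> \<le> C * (1 + c) / c"
    if "r \<in> R" "c > 0" "t \<le> real n" "real n \<le> t + 1" for r c t n
  proof -
    have C0: "0 \<le> C" using lipschitz_on_nonneg[OF lip[OF that(1)]] .
    have n: "\<bar>real (nat \<lceil>real n * c\<rceil>) - real n * c\<bar> \<le> 1"
      using that(2) by (simp add: abs_le_iff) linarith
    have "\<bar>real n * c - c * t\<bar> = c * \<bar>real n - t\<bar>"
      using that(2) by (simp add: mult.commute[of "real n"] abs_mult flip: right_diff_distrib)
    also have "\<dots> \<le> c * 1" using that by (intro mult_left_mono) auto
    finally have "\<bar>real (nat \<lceil>real n * c\<rceil>) - c * t\<bar> \<le> 1 + c" using n by linarith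
    then have "\<bar>F r (real (nat \<lceil>real n * c\<rceil>)) - F r (c * t)\<bar> \<le> C * (1 + c)"
      using lipschitz_onD[OF lip[OF that(1)], of "real (nat \<lceil>real n * c\<rceil>)" "c * t"] C0
      by (simp add: dist_real_def) (meson mult_left_mono order_trans)
    then show ?thesis
      unfolding F[OF that(1)] diff_divide_distrib[symmetric] using that by (simp add: divide_right_mono)
  qed
  define D where "D = (\<Sum>r\<in>R. C * (1 + a r) / a r + C * (1 + b) / b)"
  \<comment> \<open>Half of \<open>\<epsilon>\<close> is spent on the real-variable inequality; the
    bound \<open>2 * D / \<epsilon>\<close> makes the rounding error \<open>D\<close> fit into the
    other half.\<close>
  obtain t where t: "t \<ge> max (real N) (2 * D / \<epsilon>)"
      "(\<Sum>r\<in>R. F r (a r * t) / a r - F r (b * t) / b) > - (\<epsilon> / 2) * t"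
    by (rule scaled_averages_real[of R C F a b "\<epsilon> / 2" "max (real N) (2 * D / \<epsilon>)"]) (use lip zero a b \<epsilon> in auto)
  define n where "n = nat \<lceil>t\<rceil>"
  have t0: "t \<ge> 0" using t(1) by auto
  have n: "t \<le> real n" "real n \<le> t + 1" using t0 by (auto simp: n_def)
  show thesis
  proof
    show "N \<le> n" using t(1) n by linarith
    have "(\<Sum>r\<in>R. F r (a r * t) / a r - F r (b * t) / b) - D
        = (\<Sum>r\<in>R. F r (a r * t) / a r - F r (b * t) / b - (C * (1 + a r) / a r + C * (1 + b) / b))"
      unfolding D_def by (rule sum_subtractf[symmetric])
    also have "\<dots> \<le> (\<Sum>r\<in>R. (\<Sum>l<nat \<lceil>real n * a r\<rceil>. f r l) / a r - (\<Sum>l<nat \<lceil>real n * b\<rceil>. f r l) / b)"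
    proof (rule sum_mono)
      fix r assume r: "r \<in> R"
      show "F r (a r * t) / a r - F r (b * t) / b - (C * (1 + a r) / a r + C * (1 + b) / b)
        \<le> (\<Sum>l<nat \<lceil>real n * a r\<rceil>. f r l) / a r - (\<Sum>l<nat \<lceil>real n * b\<rceil>. f r l) / b"
        using near[OF r a[OF r] n] near[OF r b n] by linarith
    qed
    finally have "(\<Sum>r\<in>R. F r (a r * t) / a r - F r (b * t) / b) - D
        \<le> (\<Sum>r\<in>R. (\<Sum>l<nat \<lceil>real n * a r\<rceil>. f r l) / a r - (\<Sum>l<nat \<lceil>real n * b\<rceil>. f r l) / b)" .
    moreover have "2 * D \<le> \<epsilon> * t" using t(1) \<epsilon> by (simp add: field_simps)
    moreover have "\<epsilon> * t \<le> \<epsilon> * real n" using n \<epsilon> by simp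
    ultimately show "- \<epsilon> * real n
        \<le> (\<Sum>r\<in>R. (\<Sum>l<nat \<lceil>real n * a r\<rceil>. f r l) / a r - (\<Sum>l<nat \<lceil>real n * b\<rceil>. f r l) / b)"
      using t(2) by (simp add: algebra_simps)
  qed
qed

section \<open>Upper bounds for Hausdorff dimension\<close>

lemma diam_power_le:
  assumes "set_diam d U \<le> ennreal r" "0 \<le> r" "s > 0"
  shows "diam_power d s U \<le> ennreal (r powr s)"
  using assms
  by (auto simp: diam_power_def intro!: ennreal_leI powr_mono2 enn2real_leI)

text \<open>As in the Borel-Cantelli lemma: points covered infinitely often stay covered when the
  first families are dropped, and the \<open>s\<close>-sum of what remains is the tail of a
  convergent series.\<close>

lemma hausdorff_dim_le_of_covers:
  fixes d :: "'x \<Rightarrow> 'x \<Rightarrow> real" and \<U> :: "nat \<Rightarrow> 'x set set"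
  assumes fin: "\<And>n. finite (\<U> n)"
    and sub: "\<And>n U. U \<in> \<U> n \<Longrightarrow> U \<subseteq> X"
    and diam: "\<And>n U. U \<in> \<U> n \<Longrightarrow> set_diam d U \<le> ennreal (exp (- real n))"
    and cover: "\<And>x N. x \<in> E \<Longrightarrow> \<exists>n\<ge>N. x \<in> \<Union>(\<U> n)"
    and summ: "summable (\<lambda>n. real (card (\<U> n)) * exp (- s * real n))"
    and s: "s > 0"
  shows "hausdorff_dim X d E \<le> ereal s"
proof -
  define w where "w n = real (card (\<U> n)) * exp (- s * real n)" for n
  have w0: "0 \<le> w n" for n by (simp add: w_def)
  have w: "summable w" using summ by (simp add: w_def[abs_def])
  have "\<exists>h. bij_betw h {..<card (\<U> n)} (\<U> n)" for n
    using ex_bij_betw_nat_finite[OF fin[of n]] by (simp add: lessThan_atLeast0)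
  then obtain h where h: "\<And>n. bij_betw (h n) {..<card (\<U> n)} (\<U> n)" by metis
  have pre: "hausdorff_pre X d s \<delta> E \<le> ennreal e" if \<delta>: "\<delta> > 0" and e: "e > 0" for \<delta> e
  proof -
    obtain N1 where N1: "\<And>N. N \<ge> N1 \<Longrightarrow> norm (\<Sum>n. w (n + N)) < e"
      using suminf_exist_split[OF e w] by blast
    \<comment> \<open>The first entry makes the tail smaller than \<open>e\<close>, the second makes
      the diameters at most \<open>\<delta>\<close>.\<close>
    define N where "N = max N1 (nat \<lceil>- ln \<delta>\<rceil>)"
    have "- ln \<delta> \<le> real N" unfolding N_def by linarith
    then have N\<delta>: "exp (- real N) \<le> \<delta>"
      using \<delta> by (metis exp_ln exp_le_cancel_iff minus_le_iff)
    \<comment> \<open>Each finite family is enumerated and padded with empty sets, which contribute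
      0, so that pairs of indices can be coded into a single sequence of sets.\<close>
    define V where "V = (\<lambda>(m, q). if q < card (\<U> (m + N)) then h (m + N) q else {})"
    have V: "V (m, q) \<in> \<U> (m + N)" if "q < card (\<U> (m + N))" for m q
      using that h[of "m + N"] by (auto simp: V_def bij_betw_def)
    have V_ok: "V (m, q) \<subseteq> X \<and> set_diam d (V (m, q)) \<le> ennreal \<delta>" for m q
    proof (cases "q < card (\<U> (m + N))")
      case True
      have "set_diam d (V (m, q)) \<le> ennreal (exp (- real (m + N)))" using diam[OF V[OF True]] .
      also have "\<dots> \<le> ennreal (exp (- real N))" by (intro ennreal_leI) simp
      also have "\<dots> \<le> ennreal \<delta>" using N\<delta> by (rule ennreal_leI)
      finally show ?thesis using sub[OF V[OF True]] by simp
    qed (simp add: V_def set_diam_def bot_ennreal)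
    have "E \<subseteq> (\<Union>n. V (prod_decode n))"
    proof
      fix x assume "x \<in> E"
      from cover[OF this, of N] obtain n U where "n \<ge> N" "x \<in> U" "U \<in> \<U> n" by blast
      then have "U \<in> h n ` {..<card (\<U> n)}" using h[of n] by (simp add: bij_betw_def)
      then obtain q where q: "q < card (\<U> n)" "h n q = U" by auto
      then have "x \<in> V (prod_decode (prod_encode (n - N, q)))"
        using \<open>x \<in> U\<close> \<open>n \<ge> N\<close> by (simp add: V_def)
      then show "x \<in> (\<Union>n. V (prod_decode n))" by blast
    qed
    then have "hausdorff_pre X d s \<delta> E \<le> (\<Sum>n. diam_power d s (V (prod_decode n)))"
      unfolding hausdorff_pre_def using V_ok by (intro INF_lower CollectI conjI allI) (simp_all, (metis surj_pair)+)
    also have "\<dots> = (\<Sum>m. \<Sum>q. diam_power d s (V (m, q)))"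
      by (rule suminf_ennreal_2dimen) simp
    also have "\<dots> \<le> (\<Sum>m. ennreal (w (m + N)))"
    proof (intro suminf_le allI)
      fix m
      have "(\<Sum>q. diam_power d s (V (m, q))) = (\<Sum>q<card (\<U> (m + N)). diam_power d s (V (m, q)))"
        by (rule suminf_finite) (auto simp: V_def diam_power_def)
      also have "\<dots> \<le> (\<Sum>q<card (\<U> (m + N)). ennreal (exp (- s * real (m + N))))"
      proof (rule sum_mono)
        fix q assume "q \<in> {..<card (\<U> (m + N))}"
        then have "diam_power d s (V (m, q)) \<le> ennreal (exp (- real (m + N)) powr s)"
          using diam[OF V] s by (intro diam_power_le) auto
        then show "diam_power d s (V (m, q)) \<le> ennreal (exp (- s * real (m + N)))"
          by (simp add: exp_powr_real algebra_simps)
      qed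
      also have "\<dots> = ennreal (w (m + N))"
        unfolding w_def by (simp add: ennreal_mult ennreal_of_nat_eq_real_of_nat)
      finally show "(\<Sum>q. diam_power d s (V (m, q))) \<le> ennreal (w (m + N))" .
    qed auto
    also have "\<dots> = ennreal (\<Sum>m. w (m + N))"
      using w w0 by (intro suminf_ennreal2) (auto simp: summable_iff_shift)
    also have "\<dots> \<le> ennreal e" using N1[of N] by (intro ennreal_leI) (auto simp: N_def)
    finally show ?thesis .
  qed
  have "hausdorff_pre X d s \<delta> E = 0" if "\<delta> > 0" for \<delta>
  proof -
    have "hausdorff_pre X d s \<delta> E \<le> 0"
      by (rule ennreal_le_epsilon) (use pre[OF that] in auto)
    then show ?thesis by simp
  qed
  then have "hausdorff_measure X d s E = 0"
    unfolding hausdorff_measure_def by (simp add: SUP_eq_iff)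
  then show ?thesis
    unfolding hausdorff_dim_def using s by (intro INF_lower) auto
qed

text \<open>For \<open>s \<le> 0\<close> every non-empty family contributes at least 1 to the
  series, and infinitely many families are non-empty. This supplies the positivity assumed in
  \<open>hausdorff_dim_le_of_covers\<close>.\<close>

lemma cover_exponent_pos:
  fixes \<U> :: "nat \<Rightarrow> 'x set set"
  assumes fin: "\<And>n. finite (\<U> n)" and x: "\<And>N. \<exists>n\<ge>N. x \<in> \<Union>(\<U> n)"
    and summ: "summable (\<lambda>n. real (card (\<U> n)) * exp (- s * real n))"
  shows "s > 0"
proof (rule ccontr)
  assume "\<not> s > 0"
  have "eventually (\<lambda>n. norm (real (card (\<U> n)) * exp (- s * real n)) < 1) sequentially"
    using tendstoD[OF summable_LIMSEQ_zero[OF summ], of 1] by simp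
  then obtain N where N: "\<And>n. n \<ge> N \<Longrightarrow> norm (real (card (\<U> n)) * exp (- s * real n)) < 1"
    by (auto simp: eventually_sequentially)
  obtain n where n: "n \<ge> N" "x \<in> \<Union>(\<U> n)" using x by blast
  then have "\<U> n \<noteq> {}" by blast
  then have "card (\<U> n) \<ge> 1" using fin[of n] by (simp add: Suc_leI card_gt_0_iff)
  moreover have "exp (- s * real n) \<ge> 1" using \<open>\<not> s > 0\<close> by (simp add: mult_nonpos_nonneg)
  ultimately have "1 * 1 \<le> real (card (\<U> n)) * exp (- s * real n)" by (intro mult_mono) auto
  then show False using N[OF n(1)] by simp
qed

section \<open>Entropy of Bernoulli measures\<close>

lemma space_shift_space: "space (shift_space S) = {x. \<forall>n. x n \<in> S}"
  by (auto simp: shift_space_def space_PiM PiE_def)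

lemma shift_funpow: "(shift ^^ i) x = (\<lambda>n. x (n + i))"
  by (induction i arbitrary: x) (auto simp: shift_def funpow_swap1)

text \<open>The expectation of a Birkhoff sum under product weights: each coordinate has law
  \<open>q\<close>, and the remaining factors sum to 1.\<close>

lemma sum_PiE_prod_mult_sum:
  fixes q g :: "'a \<Rightarrow> real"
  assumes S: "finite S" and q: "sum q S = 1"
  shows "(\<Sum>w\<in>PiE {..<n::nat} (\<lambda>_. S). (\<Prod>l<n. q (w l)) * (\<Sum>j<n. g (w j)))
    = real n * (\<Sum>c\<in>S. q c * g c)"
proof -
  have one: "(\<Sum>w\<in>PiE {..<n} (\<lambda>_. S). (\<Prod>l<n. q (w l)) * g (w j)) = (\<Sum>c\<in>S. q c * g c)"
    if j: "j < n" for j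
  proof -
    have "(\<Sum>w\<in>PiE {..<n} (\<lambda>_. S). (\<Prod>l<n. q (w l)) * g (w j))
        = (\<Sum>w\<in>PiE {..<n} (\<lambda>_. S). \<Prod>l<n. q (w l) * (if l = j then g (w l) else 1))"
      using j by (intro sum.cong) (auto simp: prod.distrib prod.delta)
    \<comment> \<open>Absorbing \<open>g\<close> into the factor at position \<open>j\<close> gives
      a sum of products, which factorises.\<close>
    also have "\<dots> = (\<Prod>l<n. \<Sum>c\<in>S. q c * (if l = j then g c else 1))"
      using S by (intro prod_sum_PiE[symmetric]) auto
    also have "\<dots> = (\<Prod>l<n. if l = j then \<Sum>c\<in>S. q c * g c else 1)"
      using q by (intro prod.cong) auto
    finally show ?thesis using j by (simp add: prod.delta)
  qed
  show ?thesis
    unfolding sum_distrib_left by (subst sum.swap) (use one in \<open>simp add: sum_distrib_left\<close>)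
qed

text \<open>Entropy is a supremum over partitions, so for a lower bound the partition by the first letter
  suffices.\<close>

lemma ks_entropy_ge_product_cylinders:
  fixes M :: "(nat \<Rightarrow> 'a) measure" and q :: "'a \<Rightarrow> real"
  assumes sets: "sets M = sets (shift_space S)" and S: "finite S"
    and cyl: "\<And>n w. w \<in> {..<n} \<rightarrow> S \<Longrightarrow>
      measure M {x \<in> space M. \<forall>l<n. x l = w l} = (\<Prod>l<n. q (w l))"
    and q: "sum q S = 1"
  shows "ereal (- (\<Sum>c\<in>S. q c * ln (q c))) \<le> ks_entropy M shift"
proof -
  have sp: "space M = {x. \<forall>n. x n \<in> S}"
    using sets_eq_imp_space_eq[OF sets] by (simp add: space_shift_space)
  define C where "C n w = {x \<in> space M. \<forall>l<n. x l = w l}" for n and w :: "nat \<Rightarrow> 'a"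
  have "S \<noteq> {}" using q by auto
  then obtain c where "c \<in> S" by blast
  define P where "P = (\<lambda>c. {x \<in> space M. x 0 = c}) ` S"
  have "finite_partition M P"
    unfolding finite_partition_def
  proof (intro conjI)
    show "finite P" using S by (simp add: P_def)
    have "(\<lambda>x. x 0) \<in> measurable M (count_space S)"
      unfolding measurable_cong_sets[OF sets refl] shift_space_def by (rule measurable_component_singleton) simp
    then have "(\<lambda>x. x 0) -` {c} \<inter> space M \<in> sets M" if "c \<in> S" for c
      using that by (auto intro: measurable_sets)
    moreover have "(\<lambda>x. x 0) -` {c} \<inter> space M = {x \<in> space M. x 0 = c}" for c :: 'a by auto
    ultimately show "P \<subseteq> sets M" by (auto simp: P_def)
    have "(\<lambda>_. c) \<in> {x \<in> space M. x 0 = c}" if "c \<in> S" for c using that by (simp add: sp)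
    then have "{} \<notin> P" unfolding P_def by blast
    then show "partition_on (space M) P"
      by (intro partition_onI) (auto simp: P_def sp disjnt_def)
  qed
  have join: "iterated_join M shift P n = C n ` PiE {..<n} (\<lambda>_. S)" for n
  proof (intro equalityI subsetI)
    fix D assume "D \<in> iterated_join M shift P n"
    then obtain f where f: "f \<in> {..<n} \<rightarrow> P" "D = {x \<in> space M. \<forall>i<n. (shift ^^ i) x \<in> f i}"
      by (auto simp: iterated_join_def)
    then have "\<forall>i\<in>{..<n}. \<exists>c. c \<in> S \<and> f i = {x \<in> space M. x 0 = c}" by (auto simp: P_def)
    from bchoice[OF this] obtain w where "\<forall>i\<in>{..<n}. w i \<in> S \<and> f i = {x \<in> space M. x 0 = w i}"
      by (rule exE)
    then have w: "w i \<in> S" "f i = {x \<in> space M. x 0 = w i}" if "i < n" for i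
      using that by blast+
    have "D = C n (restrict w {..<n})"
      unfolding f(2) C_def using w by (auto simp: shift_funpow sp)
    moreover have "restrict w {..<n} \<in> PiE {..<n} (\<lambda>_. S)" using w by auto
    ultimately show "D \<in> C n ` PiE {..<n} (\<lambda>_. S)" by simp
  next
    fix D assume "D \<in> C n ` PiE {..<n} (\<lambda>_. S)"
    then obtain w where w: "w \<in> PiE {..<n} (\<lambda>_. S)" "D = C n w" by blast
    \<comment> \<open>Continuing the word with the fixed letter \<open>c\<close> shows that the
      cylinder is not empty, as members of the join must be.\<close>
    have "(\<lambda>l. if l < n then w l else c) \<in> D" using w \<open>c \<in> S\<close> by (auto simp: C_def sp)
    then have "D \<noteq> {}" by blast
    moreover have "D = {x \<in> space M. \<forall>i<n. (shift ^^ i) x \<in> {x \<in> space M. x 0 = w i}}"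
      unfolding w(2) C_def by (auto simp: shift_funpow sp)
    moreover have "(\<lambda>i. {x \<in> space M. x 0 = w i}) \<in> {..<n} \<rightarrow> P" using w by (auto simp: P_def)
    ultimately show "D \<in> iterated_join M shift P n"
      unfolding iterated_join_def by (intro CollectI conjI bexI)
  qed
  have inj: "inj_on (C n) (PiE {..<n} (\<lambda>_. S))" for n
  proof (rule inj_onI)
    fix v w assume v: "v \<in> PiE {..<n} (\<lambda>_. S)" and w: "w \<in> PiE {..<n} (\<lambda>_. S)" and eq: "C n v = C n w"
    have "(\<lambda>l. if l < n then v l else c) \<in> C n v" using v \<open>c \<in> S\<close> by (auto simp: C_def sp)
    then have "\<forall>l<n. v l = w l" unfolding eq by (auto simp: C_def)
    then show "v = w" using v w by (intro PiE_ext) auto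
  qed
  define H where "H = - (\<Sum>c\<in>S. q c * ln (q c))"
  have ent: "partition_entropy M (iterated_join M shift P n) = real n * H" for n
  proof -
    have "(\<Sum>D\<in>iterated_join M shift P n. measure M D * ln (measure M D))
        = (\<Sum>w\<in>PiE {..<n} (\<lambda>_. S). measure M (C n w) * ln (measure M (C n w)))"
      unfolding join by (subst sum.reindex[OF inj]) simp
    also have "\<dots> = (\<Sum>w\<in>PiE {..<n} (\<lambda>_. S). (\<Prod>l<n. q (w l)) * (\<Sum>j<n. ln (q (w j))))"
    proof (rule sum.cong[OF refl])
      fix w assume "w \<in> PiE {..<n} (\<lambda>_. S)"
      then have w: "w \<in> {..<n} \<rightarrow> S" by auto
      have m: "measure M (C n w) = (\<Prod>l<n. q (w l))" unfolding C_def by (rule cyl[OF w])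
      have "q c \<ge> 0" if "c \<in> S" for c
        using cyl[of "\<lambda>_. c" 1] that by (metis (no_types, lifting) Pi_I measure_nonneg One_nat_def lessThan_Suc prod.empty prod.insert finite.emptyI lessThan_0 empty_iff mult.right_neutral)
      \<comment> \<open>If a letter of the word has weight zero, both sides vanish; otherwise the
        logarithm of the product splits.\<close>
      then have "(\<Prod>l<n. q (w l)) = 0 \<or> (\<forall>l<n. q (w l) > 0)" using w by (force simp: Pi_iff order_less_le)
      then show "measure M (C n w) * ln (measure M (C n w)) = (\<Prod>l<n. q (w l)) * (\<Sum>j<n. ln (q (w j)))"
        unfolding m using ln_prod[of "{..<n}" "\<lambda>l. q (w l)"] by auto
    qed
    also have "\<dots> = real n * (\<Sum>c\<in>S. q c * ln (q c))"
      by (rule sum_PiE_prod_mult_sum[OF S q])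
    finally show ?thesis by (simp add: partition_entropy_def H_def)
  qed
  have "(\<lambda>n. partition_entropy M (iterated_join M shift P n) / real n) \<longlonglongrightarrow> H"
    by (rule tendsto_eventually) (auto simp: ent eventually_sequentially intro!: exI[of _ 1])
  then have "lim (\<lambda>n. partition_entropy M (iterated_join M shift P n) / real n) = H" by (rule limI)
  then show ?thesis
    unfolding ks_entropy_def H_def[symmetric]
    using \<open>finite_partition M P\<close> by (intro SUP_upper2[of P]) auto
qed

definition bernoulli :: "'a set \<Rightarrow> ('a \<Rightarrow> real) \<Rightarrow> (nat \<Rightarrow> 'a) measure" where
  "bernoulli S q = PiM UNIV (\<lambda>_. point_measure S (\<lambda>c. ennreal (q c)))"

context
  fixes S :: "'a set" and q :: "'a \<Rightarrow> real"
  assumes S: "finite S" and q0: "\<And>c. c \<in> S \<Longrightarrow> 0 \<le> q c" and q1: "sum q S = 1"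
begin

lemma prob_space_weights: "prob_space (point_measure S (\<lambda>c. ennreal (q c)))"
  using S q0 q1 by (intro prob_space_point_measure) (auto simp: sum_ennreal)

lemma sets_bernoulli: "sets (bernoulli S q) = sets (shift_space S)"
  unfolding bernoulli_def shift_space_def by (intro sets_PiM_cong) (auto simp: sets_point_measure)

lemma space_bernoulli: "space (bernoulli S q) = {x. \<forall>n. x n \<in> S}"
  using sets_eq_imp_space_eq[OF sets_bernoulli] by (simp add: space_shift_space)

lemma prob_space_bernoulli: "prob_space (bernoulli S q)"
  unfolding bernoulli_def by (intro prob_space_PiM prob_space_weights)

text \<open>The shift reindexes the coordinates along the injection \<open>Suc\<close>, and all
  factors of the product are equal.\<close>

lemma bernoulli_invariant: "bernoulli S q \<in> invariant_measures S"
proof -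
  have "distr (bernoulli S q) (shift_space S) shift = distr (bernoulli S q) (bernoulli S q) (\<lambda>x. \<lambda>n\<in>UNIV. x (Suc n))"
    by (intro distr_cong) (auto simp: sets_bernoulli shift_def)
  also have "\<dots> = bernoulli S q"
    unfolding bernoulli_def by (intro distr_PiM_reindex prob_space_weights) auto
  finally show ?thesis
    using prob_space_bernoulli sets_bernoulli by (simp add: invariant_measures_def)
qed

text \<open>General sets \<open>X l\<close> in place of letters are used because a cylinder pulled
  back along a letter map is a product of fibres.\<close>

lemma measure_bernoulli:
  assumes "\<And>l. l < n \<Longrightarrow> X l \<subseteq> S"
  shows "measure (bernoulli S q) {x \<in> space (bernoulli S q). \<forall>l<n. x l \<in> X l} = (\<Prod>l<n. sum q (X l))"
proof -
  let ?N = "\<lambda>_::nat. point_measure S (\<lambda>c. ennreal (q c))"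
  interpret product_prob_space ?N UNIV
    by (intro product_prob_spaceI prob_space_weights)
  have "0 \<le> (\<Prod>l<n. sum q (X l))"
    using assms q0 by (intro prod_nonneg ballI sum_nonneg) blast
  have fin: "finite (X l)" if "l < n" for l using assms[OF that] S finite_subset by blast
  have "emeasure (PiM UNIV ?N) {x \<in> space (PiM UNIV ?N). \<forall>l\<in>{..<n}. x l \<in> X l}
      = (\<Prod>l<n. emeasure (?N l) (X l))"
    using assms by (intro emeasure_PiM_Collect) (auto simp: sets_point_measure)
  also have "\<dots> = (\<Prod>l<n. ennreal (sum q (X l)))"
    using assms S q0 fin
    by (intro prod.cong refl) (subst emeasure_point_measure_finite, auto intro!: sum_ennreal)
  also have "\<dots> = ennreal (\<Prod>l<n. sum q (X l))"
    using assms q0 by (intro prod_ennreal sum_nonneg) auto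
  finally have "emeasure (bernoulli S q) {x \<in> space (bernoulli S q). \<forall>l<n. x l \<in> X l}
      = ennreal (\<Prod>l<n. sum q (X l))"
    by (simp add: bernoulli_def lessThan_def)
  then show ?thesis
    unfolding measure_def using \<open>0 \<le> (\<Prod>l<n. sum q (X l))\<close> by simp
qed

lemma integral_bernoulli:
  "(\<integral>x. g (x 0) \<partial>bernoulli S q) = (\<Sum>c\<in>S. q c * (g c :: real))"
proof -
  let ?N = "\<lambda>_::nat. point_measure S (\<lambda>c. ennreal (q c))"
  have "(\<integral>c. g c \<partial>distr (PiM UNIV ?N) (?N 0) (\<lambda>x. x 0)) = (\<integral>x. g (x 0) \<partial>PiM UNIV ?N)"
    by (intro integral_distr) auto
  moreover have "distr (PiM UNIV ?N) (?N 0) (\<lambda>x. x 0) = ?N 0"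
    by (intro distr_PiM_component prob_space_weights) auto
  ultimately show ?thesis
    using S q0 by (simp add: bernoulli_def lebesgue_integral_point_measure_finite)
qed

text \<open>A letter-by-letter factor of a Bernoulli measure gives cylinders product measure with
  the fibre weights \<open>r\<close>. The entropy is kept as a sum over \<open>S\<close>, ready to
  be combined with the Euler-Lagrange equation.\<close>

lemma ks_entropy_bernoulli_factor_ge:
  assumes T: "finite T" and f: "f ` S \<subseteq> T"
  defines "r \<equiv> \<lambda>c. sum q {b \<in> S. f b = c}"
  shows "ereal (- (\<Sum>b\<in>S. q b * ln (r (f b))))
    \<le> ks_entropy (distr (bernoulli S q) (shift_space T) (\<lambda>x n. f (x n))) shift"
proof -
  let ?M = "distr (bernoulli S q) (shift_space T) (\<lambda>x n. f (x n))"
  have meas: "(\<lambda>x n. f (x n)) \<in> measurable (bernoulli S q) (shift_space T)"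
    unfolding shift_space_def
  proof (rule measurable_PiM_single')
    show "(\<lambda>x. f (x n)) \<in> measurable (bernoulli S q) (count_space T)" for n
      using f by (intro measurable_compose[of "\<lambda>x. x n" _ "count_space S" f])
        (auto simp: measurable_cong_sets[OF sets_bernoulli refl] shift_space_def)
    show "(\<lambda>x n. f (x n)) \<in> space (bernoulli S q) \<rightarrow> (\<Pi>\<^sub>E i\<in>UNIV. space (count_space T))"
      using f by (auto simp: space_bernoulli)
  qed
  have r1: "sum r T = 1"
    unfolding r_def using S T f q1 by (subst sum.group) auto
  have "ereal (- (\<Sum>c\<in>T. r c * ln (r c))) \<le> ks_entropy ?M shift"
  proof (rule ks_entropy_ge_product_cylinders)
    fix n and w :: "nat \<Rightarrow> 'b" assume w: "w \<in> {..<n} \<rightarrow> T"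
    have c: "{x \<in> space ?M. \<forall>l<n. x l = w l} \<in> sets ?M"
    proof -
      have "Measurable.pred (shift_space T) (\<lambda>x. \<forall>l\<in>{..<n}. x l = w l)"
      proof (intro pred_intros_finite)
        fix l
        assume "l \<in> {..<n}"
        have "(\<lambda>x. x l) \<in> measurable (shift_space T) (count_space T)"
          unfolding shift_space_def by (rule measurable_component_singleton) simp
        then show "Measurable.pred (shift_space T) (\<lambda>x. x l = w l)"
          by (intro measurable_compose[where g="\<lambda>c. c = w l" and N="count_space T" and f="\<lambda>x. x l"]) auto
      qed simp
      then have "{x \<in> space (shift_space T). \<forall>l\<in>{..<n}. x l = w l} \<in> sets (shift_space T)"
        by (simp only: pred_def)
      moreover have "(\<forall>l\<in>{..<n}. x l = w l) \<longleftrightarrow> (\<forall>l<n. x l = w l)" for x by auto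
      ultimately show ?thesis by (simp only: space_distr sets_distr)
    qed
    have "measure ?M {x \<in> space ?M. \<forall>l<n. x l = w l}
        = measure (bernoulli S q) ((\<lambda>x n. f (x n)) -` {x \<in> space ?M. \<forall>l<n. x l = w l} \<inter> space (bernoulli S q))"
      by (rule measure_distr[OF meas c[unfolded sets_distr]])
    also have "(\<lambda>x n. f (x n)) -` {x \<in> space ?M. \<forall>l<n. x l = w l} \<inter> space (bernoulli S q)
        = {x \<in> space (bernoulli S q). \<forall>l<n. x l \<in> {b \<in> S. f b = w l}}"
      using f by (auto simp: space_bernoulli space_shift_space)
    also have "measure (bernoulli S q) \<dots> = (\<Prod>l<n. r (w l))"
      unfolding r_def by (rule measure_bernoulli) auto
    finally show "measure ?M {x \<in> space ?M. \<forall>l<n. x l = w l} = (\<Prod>l<n. r (w l))" .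
  qed (use T r1 in auto)
  also have "(\<Sum>c\<in>T. r c * ln (r c)) = (\<Sum>b\<in>S. q b * ln (r (f b)))"
  proof -
    have "(\<Sum>b\<in>S. q b * ln (r (f b))) = (\<Sum>c\<in>T. \<Sum>b\<in>{b\<in>S. f b = c}. q b * ln (r (f b)))"
      using S T f by (intro sum.group[symmetric]) auto
    also have "\<dots> = (\<Sum>c\<in>T. r c * ln (r c))"
      unfolding r_def by (intro sum.cong refl) (simp add: sum_distrib_right)
    finally show ?thesis by simp
  qed
  finally show ?thesis .
qed

end

section \<open>Equilibrium weights\<close>

text \<open>The mass at \<open>c\<close> of the push-forward of the weights \<open>q\<close> under
  \<open>f\<close>.\<close>

definition fibre_sum :: "('a \<Rightarrow> 'b) \<Rightarrow> 'a set \<Rightarrow> ('a \<Rightarrow> real) \<Rightarrow> 'b \<Rightarrow> real" where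
  "fibre_sum f S q c = sum q {b \<in> S. f b = c}"

lemma proj_Suc: "i < j \<Longrightarrow> proj p i j a = proj p (Suc i) j (p i a)"
  by (simp add: proj_def upt_conv_Cons)

lemma proj_self [simp]: "proj p i i a = a"
  by (simp add: proj_def)

lemma gsum_Suc: "gsum \<gamma> (Suc i) = gsum \<gamma> i + \<gamma> (Suc i)"
  by (simp add: gsum_def)

lemma gsum_pos:
  assumes "\<And>j. 1 \<le> j \<Longrightarrow> j \<le> k \<Longrightarrow> \<gamma> j > 0" "1 \<le> i" "i \<le> k"
  shows "gsum \<gamma> i > 0"
  unfolding gsum_def using assms by (intro sum_pos) auto

text \<open>The equilibrium state of the weighted pressure, characterised by its Euler-Lagrange equation.
  The fibre over a letter \<open>c\<close> of the next alphabet is weighted by \<open>exp \<phi>\<close>, and the normalising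
  constant of that fibre becomes the potential at \<open>c\<close>.\<close>

lemma weighted_equilibrium:
  assumes \<gamma>: "\<And>j. 1 \<le> j \<Longrightarrow> j \<le> k \<Longrightarrow> \<gamma> j > 0"
    and "1 \<le> i" "i \<le> k" and "finite S" "S \<noteq> {}"
  shows "\<exists>\<nu> Q. (\<forall>b\<in>S. \<nu> b > 0) \<and> sum \<nu> S = 1 \<and>
    (\<forall>b\<in>S. gsum \<gamma> i * \<phi> b = Q + gsum \<gamma> i * ln (\<nu> b)
      + (\<Sum>j=i+1..k. \<gamma> j * ln (fibre_sum (proj p i j) S \<nu> (proj p i j b))))"
  using \<open>i \<le> k\<close> \<open>1 \<le> i\<close> \<open>finite S\<close> \<open>S \<noteq> {}\<close>
proof (induction i arbitrary: S \<phi> rule: inc_induct)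
  case base
  \<comment> \<open>At level \<open>k\<close> the sum over coarser levels is empty and the Gibbs
    weights solve the equation.\<close>
  define Z where "Z = (\<Sum>b\<in>S. exp (\<phi> b))"
  have Z: "Z > 0" unfolding Z_def using base by (intro sum_pos) auto
  show ?case
  proof (intro exI[of _ "\<lambda>b. exp (\<phi> b) / Z"] exI[of _ "gsum \<gamma> k * ln Z"] conjI ballI)
    show "(\<Sum>b\<in>S. exp (\<phi> b) / Z) = 1" using Z by (simp add: Z_def flip: sum_divide_distrib)
    fix b assume "b \<in> S"
    show "gsum \<gamma> k * \<phi> b = gsum \<gamma> k * ln Z + gsum \<gamma> k * ln (exp (\<phi> b) / Z) +
      (\<Sum>j=k+1..k. \<gamma> j * ln (fibre_sum (proj p k j) S (\<lambda>b. exp (\<phi> b) / Z) (proj p k j b)))"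
      using Z by (simp add: ln_div algebra_simps)
  qed (use Z in auto)
next
  case (step i)
  define F where "F c = {b \<in> S. p i b = c}" for c
  have F_fin: "finite (F c)" for c using step.prems by (simp add: F_def)
  define Z where "Z c = (\<Sum>b\<in>F c. exp (\<phi> b))" for c
  have Z: "Z (p i b) > 0" if "b \<in> S" for b
    unfolding Z_def using that F_fin by (intro sum_pos) (auto simp: F_def)
  have g0: "gsum \<gamma> i > 0" "gsum \<gamma> (Suc i) > 0"
    using step.prems step.hyps by (auto intro!: gsum_pos[OF \<gamma>])
  \<comment> \<open>The ratio passes from the factor \<open>gsum \<gamma> i\<close> to the factor
    \<open>gsum \<gamma> (Suc i)\<close> that the equation at the next level carries.\<close>
  define \<phi>' where "\<phi>' c = gsum \<gamma> i / gsum \<gamma> (Suc i) * ln (Z c)" for c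
  have \<phi>': "gsum \<gamma> (Suc i) * \<phi>' c = gsum \<gamma> i * ln (Z c)" for c
    using g0 by (simp add: \<phi>'_def)
  obtain \<nu>' Q where \<nu>'0: "\<And>c. c \<in> p i ` S \<Longrightarrow> \<nu>' c > 0" and \<nu>'1: "sum \<nu>' (p i ` S) = 1"
    and EL: "\<And>c. c \<in> p i ` S \<Longrightarrow> gsum \<gamma> (Suc i) * \<phi>' c = Q + gsum \<gamma> (Suc i) * ln (\<nu>' c)
      + (\<Sum>j=Suc i+1..k. \<gamma> j * ln (fibre_sum (proj p (Suc i) j) (p i ` S) \<nu>' (proj p (Suc i) j c)))"
    using step.IH[of "p i ` S" \<phi>'] step.prems by auto
  \<comment> \<open>The image letter is chosen by \<open>\<nu>'\<close>, then a letter of its fibre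
    by the Gibbs weights there; all coarser marginals are thus inherited from
    \<open>\<nu>'\<close>.\<close>
  define \<nu> where "\<nu> b = \<nu>' (p i b) * exp (\<phi> b) / Z (p i b)" for b
  have \<nu>_fibre: "sum \<nu> (F c) = \<nu>' c" if "c \<in> p i ` S" for c
  proof -
    have "sum \<nu> (F c) = (\<Sum>b\<in>F c. \<nu>' c / Z c * exp (\<phi> b))"
      by (rule sum.cong) (auto simp: \<nu>_def F_def)
    also have "\<dots> = \<nu>' c / Z c * Z c" by (simp add: Z_def sum_distrib_left)
    also have "\<dots> = \<nu>' c" using that Z by force
    finally show ?thesis .
  qed
  have fibre: "fibre_sum (proj p i j) S \<nu> d = fibre_sum (proj p (Suc i) j) (p i ` S) \<nu>' d"
    if "i < j" for j d
  proof -
    let ?B = "{c \<in> p i ` S. proj p (Suc i) j c = d}"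
    have "(\<Sum>c\<in>?B. \<Sum>b\<in>{b \<in> {b \<in> S. proj p i j b = d}. p i b = c}. \<nu> b) = sum \<nu> {b \<in> S. proj p i j b = d}"
      using step.prems that by (intro sum.group) (auto simp: proj_Suc)
    moreover have "(\<Sum>b\<in>{b \<in> {b \<in> S. proj p i j b = d}. p i b = c}. \<nu> b) = \<nu>' c" if c: "c \<in> ?B" for c
    proof -
      have "{b \<in> {b \<in> S. proj p i j b = d}. p i b = c} = F c"
        using c \<open>i < j\<close> by (auto simp: F_def proj_Suc)
      then show ?thesis using \<nu>_fibre c by simp
    qed
    ultimately show ?thesis by (simp add: fibre_sum_def)
  qed
  show ?case
  proof (intro exI[of _ \<nu>] exI[of _ Q] conjI ballI)
    show "\<nu> b > 0" if "b \<in> S" for b using that Z \<nu>'0 by (simp add: \<nu>_def)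
    have "(\<Sum>c\<in>p i ` S. sum \<nu> {b \<in> S. p i b = c}) = sum \<nu> S"
      using step.prems by (intro sum.group) auto
    then show "sum \<nu> S = 1" using \<nu>_fibre \<nu>'1 by (simp add: F_def)
    fix b assume b: "b \<in> S"
    have *: "(\<Sum>j=i+1..k. \<gamma> j * ln (fibre_sum (proj p i j) S \<nu> (proj p i j b)))
      = (\<Sum>j=Suc i..k. \<gamma> j * ln (fibre_sum (proj p (Suc i) j) (p i ` S) \<nu>' (proj p (Suc i) j (p i b))))"
      by (intro sum.cong) (auto simp: fibre proj_Suc)
    also have "\<dots> = \<gamma> (Suc i) * ln (\<nu>' (p i b))
      + (\<Sum>j=Suc i+1..k. \<gamma> j * ln (fibre_sum (proj p (Suc i) j) (p i ` S) \<nu>' (proj p (Suc i) j (p i b))))"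
    \<comment> \<open>The term for level \<open>Suc i\<close> is \<open>\<nu>'\<close> itself; its
      factor \<open>\<gamma> (Suc i)\<close> lowers the coefficient of
      \<open>ln (\<nu>' (p i b))\<close> from \<open>gsum \<gamma> (Suc i)\<close> to
      \<open>gsum \<gamma> i\<close>.\<close>
    proof -
      have "fibre_sum (proj p (Suc i) (Suc i)) (p i ` S) \<nu>' (p i b) = \<nu>' (p i b)"
      proof -
        have "{c \<in> p i ` S. c = p i b} = {p i b}" using b by auto
        then show ?thesis by (simp add: fibre_sum_def)
      qed
      then show ?thesis using step.hyps by (subst sum.atLeast_Suc_atMost) auto
    qed
    finally have "(\<Sum>j=i+1..k. \<gamma> j * ln (fibre_sum (proj p i j) S \<nu> (proj p i j b)))
      = gsum \<gamma> i * ln (Z (p i b)) - Q - gsum \<gamma> i * ln (\<nu>' (p i b))"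
      using EL[of "p i b"] b unfolding \<phi>' by (simp add: gsum_Suc algebra_simps)
    moreover have "ln (\<nu> b) = ln (\<nu>' (p i b)) + \<phi> b - ln (Z (p i b))"
      unfolding \<nu>_def using \<nu>'0[of "p i b"] Z[of b] b by (simp add: ln_mult ln_div)
    then have "gsum \<gamma> i * ln (\<nu> b) = gsum \<gamma> i * (ln (\<nu>' (p i b)) + \<phi> b - ln (Z (p i b)))" by simp
    ultimately show "gsum \<gamma> i * \<phi> b = Q + gsum \<gamma> i * ln (\<nu> b)
      + (\<Sum>j=i+1..k. \<gamma> j * ln (fibre_sum (proj p i j) S \<nu> (proj p i j b)))"
      by (simp add: algebra_simps)
  qed
qed

section \<open>Surviving words and covers of the sponge\<close>

lemma proj_compose:
  assumes "i \<le> j" "j \<le> m"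
  shows "proj p i m a = proj p j m (proj p i j a)"
  using assms(2,1) by (induction m rule: dec_induct) (auto simp: proj_def)

text \<open>Taking logarithms in the metric turns the radius \<open>exp (- n)\<close> into agreement
  of the projections to level \<open>j\<close> up to length \<open>n * gsum \<gamma> j\<close>;
  rounding up only lengthens the agreement.\<close>

lemma sponge_dist_le:
  assumes k: "1 \<le> k" and g: "\<And>j. 1 \<le> j \<Longrightarrow> j \<le> k \<Longrightarrow> gsum \<gamma> j > 0"
    and agree: "\<And>j l. 1 \<le> j \<Longrightarrow> j \<le> k \<Longrightarrow> l < nat \<lceil>real n * gsum \<gamma> j\<rceil> \<Longrightarrow> proj p 1 j (x l) = proj p 1 j (y l)"
  shows "sponge_dist p \<gamma> k x y \<le> exp (- real n)"
  unfolding sponge_dist_def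
proof (rule Max.boundedI)
  fix d assume "d \<in> (\<lambda>j. if proj_seq p 1 j x = proj_seq p 1 j y then 0
    else exp (- real (common_prefix (proj_seq p 1 j x) (proj_seq p 1 j y)) / gsum \<gamma> j)) ` {1..k}"
  then obtain j where j: "1 \<le> j" "j \<le> k" and d: "d = (if proj_seq p 1 j x = proj_seq p 1 j y then 0
    else exp (- real (common_prefix (proj_seq p 1 j x) (proj_seq p 1 j y)) / gsum \<gamma> j))" by auto
  show "d \<le> exp (- real n)"
  proof (cases "proj_seq p 1 j x = proj_seq p 1 j y")
    case False
    define c where "c = common_prefix (proj_seq p 1 j x) (proj_seq p 1 j y)"
    from False have "\<exists>l. proj_seq p 1 j x l \<noteq> proj_seq p 1 j y l" by blast
    then have "proj_seq p 1 j x c \<noteq> proj_seq p 1 j y c"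
      unfolding c_def common_prefix_def by (rule LeastI_ex)
    then have "\<not> c < nat \<lceil>real n * gsum \<gamma> j\<rceil>"
      using agree[OF j, of c] by (auto simp: proj_seq_def)
    then have "real n * gsum \<gamma> j \<le> real c" by linarith
    then have "real n \<le> real c / gsum \<gamma> j" using g[OF j] by (simp add: pos_le_divide_eq)
    then show ?thesis unfolding d if_not_P[OF False] c_def[symmetric] by simp
  qed (simp add: d)
next
  show "(\<lambda>j. if proj_seq p 1 j x = proj_seq p 1 j y then 0
    else exp (- real (common_prefix (proj_seq p 1 j x) (proj_seq p 1 j y)) / gsum \<gamma> j)) ` {1..k} \<noteq> {}"
    unfolding image_is_empty using k by simp
qed simp

text \<open>Abel summation. For \<open>g = gsum \<gamma>\<close> the increments on the right are the
  entries of \<open>\<gamma>\<close>.\<close>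

lemma sum_by_parts:
  fixes g u :: "nat \<Rightarrow> real"
  assumes "i \<le> k"
  shows "(\<Sum>r=i..k. g r * (u r - u (Suc r)))
    = g i * u i + (\<Sum>j=Suc i..k. (g j - g (j - 1)) * u j) - g k * u (Suc k)"
  using assms by (induction k rule: dec_induct) (auto simp: algebra_simps)

locale random_sponge = prob_space \<Omega> for \<Omega> :: "'w measure" +
  fixes k :: nat
    and Al :: "nat \<Rightarrow> 'a set"
    and p :: "nat \<Rightarrow> 'a \<Rightarrow> 'a"
    and \<gamma> :: "nat \<Rightarrow> real"
    and A0 :: "'w \<Rightarrow> 'a set"
    and A :: "'a list \<Rightarrow> 'w \<Rightarrow> 'a set"
  assumes k: "k \<ge> 2"
    and alphabets: "\<And>i. 1 \<le> i \<Longrightarrow> i \<le> k \<Longrightarrow> finite (Al i)"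
    and factor_maps: "\<And>i. 1 \<le> i \<Longrightarrow> i \<le> k - 1 \<Longrightarrow> p i ` Al i = Al (i + 1)"
    and gamma_pos: "\<And>i. 1 \<le> i \<Longrightarrow> i \<le> k \<Longrightarrow> \<gamma> i > 0"
    and A0: "A0 \<in> measurable \<Omega> (count_space (Pow (Al 1)))"
    and indep: "indep_vars (\<lambda>_. count_space (Pow (Al 1))) A (lists (Al 1))"
    and copies: "\<And>u. u \<in> lists (Al 1) \<Longrightarrow>
      distr \<Omega> (count_space (Pow (Al 1))) (A u) = distr \<Omega> (count_space (Pow (Al 1))) A0"
    and reduced: "reduced_alphabet Al p \<Omega> A0 k \<noteq> {}"
begin

section \<open>Letter probabilities and expected numbers of surviving words\<close>

definition letter_prob :: "'a \<Rightarrow> real" where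
  "letter_prob a = prob {\<omega> \<in> space \<Omega>. a \<in> A0 \<omega>}"

definition survives :: "nat \<Rightarrow> (nat \<Rightarrow> 'a) \<Rightarrow> 'w \<Rightarrow> bool" where
  "survives m v \<omega> \<longleftrightarrow> (\<forall>l<m. v l \<in> A (map v [0..<l]) \<omega>)"

lemma finite_Al1: "finite (Al 1)"
  using alphabets[of 1] k by simp

lemma gsum_positive: "1 \<le> j \<Longrightarrow> j \<le> k \<Longrightarrow> gsum \<gamma> j > 0"
  by (rule gsum_pos[OF gamma_pos])

lemma gsum_mono: "i \<le> j \<Longrightarrow> j \<le> k \<Longrightarrow> gsum \<gamma> i \<le> gsum \<gamma> j"
  unfolding gsum_def by (intro sum_mono2) (auto intro!: less_imp_le[OF gamma_pos])

lemma proj_in: "1 \<le> i \<Longrightarrow> i \<le> j \<Longrightarrow> j \<le> k \<Longrightarrow> a \<in> Al i \<Longrightarrow> proj p i j a \<in> Al j"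
proof -
  assume "i \<le> j" "1 \<le> i" "j \<le> k" "a \<in> Al i"
  then show ?thesis
  proof (induction j rule: dec_induct)
    case (step j)
    then have "p j ` Al j = Al (Suc j)" using factor_maps[of j] by simp
    then show ?case using step by (auto simp: proj_def)
  qed simp
qed

lemma A_measurable: "u \<in> lists (Al 1) \<Longrightarrow> A u \<in> measurable \<Omega> (count_space (Pow (Al 1)))"
  using indep by (auto simp: indep_vars_def)

lemma letter_event:
  assumes "X \<in> measurable \<Omega> (count_space (Pow (Al 1)))"
  shows "X -` {B \<in> Pow (Al 1). a \<in> B} \<inter> space \<Omega> = {\<omega> \<in> space \<Omega>. a \<in> X \<omega>}"
    and "{\<omega> \<in> space \<Omega>. a \<in> X \<omega>} \<in> events"
    and "measure (distr \<Omega> (count_space (Pow (Al 1))) X) {B \<in> Pow (Al 1). a \<in> B} = prob {\<omega> \<in> space \<Omega>. a \<in> X \<omega>}"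
proof -
  show *: "X -` {B \<in> Pow (Al 1). a \<in> B} \<inter> space \<Omega> = {\<omega> \<in> space \<Omega>. a \<in> X \<omega>}"
    using measurable_space[OF assms] by auto
  show "{\<omega> \<in> space \<Omega>. a \<in> X \<omega>} \<in> events"
    unfolding *[symmetric] by (rule measurable_sets[OF assms]) auto
  show "measure (distr \<Omega> (count_space (Pow (Al 1))) X) {B \<in> Pow (Al 1). a \<in> B} = prob {\<omega> \<in> space \<Omega>. a \<in> X \<omega>}"
    unfolding *[symmetric] by (rule measure_distr[OF assms]) auto
qed

lemma prob_letter:
  assumes u: "u \<in> lists (Al 1)"
  shows "prob {\<omega> \<in> space \<Omega>. a \<in> A u \<omega>} = letter_prob a"
  using letter_event(3)[OF A_measurable[OF u]] letter_event(3)[OF A0]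
  unfolding copies[OF u] letter_prob_def by metis

text \<open>By linearity of expectation the correlations among the letters of one random set
  disappear.\<close>

lemma exp_count_eq: "exp_count p \<Omega> A0 i b = (\<Sum>a | a \<in> Al 1 \<and> proj p 1 i a = b. letter_prob a)"
proof -
  let ?F = "{a \<in> Al 1. proj p 1 i a = b}"
  have fin: "finite ?F" using finite_Al1 by simp
  have "exp_count p \<Omega> A0 i b = (\<integral>\<omega>. (\<Sum>a\<in>?F. indicator {\<omega> \<in> space \<Omega>. a \<in> A0 \<omega>} \<omega>) \<partial>\<Omega>)"
    unfolding exp_count_def
  proof (rule Bochner_Integration.integral_cong[OF refl])
    fix \<omega> assume \<omega>: "\<omega> \<in> space \<Omega>"
    then have "A0 \<omega> \<subseteq> Al 1" using measurable_space[OF A0] by auto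
    then have "{a \<in> A0 \<omega>. proj p 1 i a = b} = {a \<in> ?F. a \<in> A0 \<omega>}" by auto
    then show "real (card {a \<in> A0 \<omega>. proj p 1 i a = b}) = (\<Sum>a\<in>?F. indicator {\<omega> \<in> space \<Omega>. a \<in> A0 \<omega>} \<omega>)"
      using fin \<omega> by (simp add: indicator_def sum.If_cases Int_def)
  qed
  also have "\<dots> = (\<Sum>a\<in>?F. letter_prob a)"
    using letter_event(2)[OF A0] by (subst Bochner_Integration.integral_sum) (auto simp: letter_prob_def less_top[symmetric] intro!: integrable_real_indicator)
  finally show ?thesis .
qed

lemma letter_prob_nonneg: "0 \<le> letter_prob a"
  by (simp add: letter_prob_def)

lemma exp_count_nonneg: "0 \<le> exp_count p \<Omega> A0 i b"
  unfolding exp_count_eq by (intro sum_nonneg letter_prob_nonneg)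

lemma proj_in_reduced:
  assumes "1 \<le> i" "i \<le> k" "a \<in> Al 1" "letter_prob a > 0"
  shows "proj p 1 i a \<in> reduced_alphabet Al p \<Omega> A0 i"
proof -
  have "0 < letter_prob a" by fact
  also have "\<dots> \<le> exp_count p \<Omega> A0 i (proj p 1 i a)"
    unfolding exp_count_eq using assms finite_Al1 by (intro member_le_sum) (auto simp: letter_prob_nonneg)
  finally show ?thesis using proj_in[of 1 i a] assms by (simp add: reduced_alphabet_def)
qed

lemma finite_reduced: "1 \<le> i \<Longrightarrow> i \<le> k \<Longrightarrow> finite (reduced_alphabet Al p \<Omega> A0 i)"
  using alphabets by (auto simp: reduced_alphabet_def)

lemma reduced_nonempty:
  assumes "1 \<le> i" "i \<le> k"
  shows "reduced_alphabet Al p \<Omega> A0 i \<noteq> {}"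
proof -
  obtain d where "exp_count p \<Omega> A0 k d > 0" using reduced by (auto simp: reduced_alphabet_def)
  then have "(\<Sum>a | a \<in> Al 1 \<and> proj p 1 k a = d. letter_prob a) > 0" by (simp only: exp_count_eq)
  then obtain a where "a \<in> Al 1" "letter_prob a > 0"
    by (metis (no_types, lifting) mem_Collect_eq not_le sum_nonpos)
  then show ?thesis using proj_in_reduced[OF assms] by blast
qed

text \<open>The prefixes of a word have distinct lengths, so the random sets attached to them are
  independent copies and the survival probability factorises.\<close>

lemma survives_event_prob:
  assumes v: "v \<in> {..<m} \<rightarrow> Al 1"
  shows "{\<omega> \<in> space \<Omega>. survives m v \<omega>} \<in> events"
    and "prob {\<omega> \<in> space \<Omega>. survives m v \<omega>} = (\<Prod>l<m. letter_prob (v l))"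
proof -
  define w where "w l = map v [0..<l]" for l
  have w: "w l \<in> lists (Al 1)" if "l < m" for l using v that by (force simp: w_def)
  have inj: "inj_on w {..<m}"
    by (rule inj_on_inverseI[of _ length]) (simp add: w_def)
  define B where "B u = {B \<in> Pow (Al 1). v (length u) \<in> B}" for u :: "'a list"
  have ev: "A (w l) -` B (w l) \<inter> space \<Omega> = {\<omega> \<in> space \<Omega>. v l \<in> A (w l) \<omega>}" if "l < m" for l
    using letter_event(1)[OF A_measurable[OF w[OF that]]] by (simp add: B_def w_def)
  \<comment> \<open>For \<open>m = 0\<close> the intersection over an empty index set would be the
    whole type and not \<open>space \<Omega>\<close>.\<close>
  have eq: "{\<omega> \<in> space \<Omega>. survives m v \<omega>} = (\<Inter>l\<in>{..<m}. {\<omega> \<in> space \<Omega>. v l \<in> A (w l) \<omega>})" if "m \<noteq> 0"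
    using that by (auto simp: survives_def w_def)
  show "{\<omega> \<in> space \<Omega>. survives m v \<omega>} \<in> events"
  proof (cases "m = 0")
    case False
    then show ?thesis
      unfolding eq[OF False]
      by (intro sets.finite_INT) (auto intro!: letter_event(2) A_measurable w)
  qed (simp add: survives_def)
  show "prob {\<omega> \<in> space \<Omega>. survives m v \<omega>} = (\<Prod>l<m. letter_prob (v l))"
  proof (cases "m = 0")
    case False
    have "{\<omega> \<in> space \<Omega>. survives m v \<omega>} = (\<Inter>u\<in>w ` {..<m}. A u -` B u \<inter> space \<Omega>)"
      unfolding eq[OF False] image_image by (rule INF_cong) (use ev in auto)
    also have "prob \<dots> = (\<Prod>u\<in>w ` {..<m}. prob (A u -` B u \<inter> space \<Omega>))"
      using False w by (intro indep_varsD[OF indep]) (auto simp: B_def)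
    also have "\<dots> = (\<Prod>l<m. prob (A (w l) -` B (w l) \<inter> space \<Omega>))"
      by (simp add: prod.reindex[OF inj])
    also have "\<dots> = (\<Prod>l<m. letter_prob (v l))"
      using ev w prob_letter by (intro prod.cong) auto
    finally show ?thesis .
  qed (simp add: survives_def prob_space)
qed

text \<open>First-moment formula: expanding the product of fibre sums enumerates the words above
  \<open>c\<close>.\<close>

lemma expected_survivors:
  "(\<Sum>v\<in>PiE {..<m} (\<lambda>l. {a \<in> Al 1. proj p 1 i a = c l}). prob {\<omega> \<in> space \<Omega>. survives m v \<omega>})
    = (\<Prod>l<m. exp_count p \<Omega> A0 i (c l))"
proof -
  have "(\<Prod>l<m. exp_count p \<Omega> A0 i (c l))
      = (\<Sum>v\<in>PiE {..<m} (\<lambda>l. {a \<in> Al 1. proj p 1 i a = c l}). \<Prod>l<m. letter_prob (v l))"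
    unfolding exp_count_eq using finite_Al1 by (intro prod_sum_PiE) auto
  also have "\<dots> = (\<Sum>v\<in>PiE {..<m} (\<lambda>l. {a \<in> Al 1. proj p 1 i a = c l}). prob {\<omega> \<in> space \<Omega>. survives m v \<omega>})"
    by (intro sum.cong refl survives_event_prob(2)[symmetric]) (auto simp: PiE_iff Pi_iff)
  finally show ?thesis by simp
qed

text \<open>There are only countably many words and finitely many letters. Almost surely the
  projected letters of the sponge thus lie in the reduced alphabets, where logarithms of expected
  counts behave as usual.\<close>

lemma AE_letters_positive:
  "AE \<omega> in \<Omega>. \<forall>u\<in>lists (Al 1). \<forall>a. a \<in> A u \<omega> \<longrightarrow> a \<in> Al 1 \<and> letter_prob a > 0"
proof -
  have null: "AE \<omega> in \<Omega>. letter_prob a = 0 \<longrightarrow> a \<notin> A u \<omega>" if u: "u \<in> lists (Al 1)" for u a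
  proof (cases "letter_prob a = 0")
    case True
    have "AE \<omega> in \<Omega>. \<not> a \<in> A u \<omega>"
      using True prob_letter[OF u] letter_event(2)[OF A_measurable[OF u]]
      by (subst AE_iff_measurable[OF _ refl]) (auto simp: emeasure_eq_measure)
    then show ?thesis by auto
  qed simp
  have "AE \<omega> in \<Omega>. \<forall>u\<in>lists (Al 1). \<forall>a\<in>Al 1. letter_prob a = 0 \<longrightarrow> a \<notin> A u \<omega>"
    using null finite_Al1 by (auto simp: AE_ball_countable countable_finite)
  moreover have "AE \<omega> in \<Omega>. \<omega> \<in> space \<Omega>" by (rule AE_space)
  ultimately show ?thesis
  proof eventually_elim
    case (elim \<omega>)
    show ?case
    proof (intro ballI allI impI)
      fix u a assume u: "u \<in> lists (Al 1)" and a: "a \<in> A u \<omega>"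
      have "A u \<omega> \<subseteq> Al 1" using measurable_space[OF A_measurable[OF u]] elim by auto
      then show "a \<in> Al 1 \<and> letter_prob a > 0"
        using a u elim letter_prob_nonneg[of a] by (auto simp: order_less_le)
    qed
  qed
qed

section \<open>Balls of radius \<open>exp (- n)\<close>, their codes and their pieces\<close>

definition len :: "nat \<Rightarrow> nat \<Rightarrow> nat" where
  "len n j = nat \<lceil>real n * gsum \<gamma> j\<rceil>"

lemma len_mono: "i \<le> j \<Longrightarrow> j \<le> k \<Longrightarrow> len n i \<le> len n j"
  unfolding len_def by (intro nat_mono ceiling_mono mult_left_mono gsum_mono) auto

context
  fixes i :: nat and t :: real and \<nu> :: "'a \<Rightarrow> real" and Q \<epsilon> :: real
  assumes i: "2 \<le> i" "i \<le> k" and t: "0 \<le> t" "t \<le> 1" and \<epsilon>: "\<epsilon> > 0"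
    and \<nu>_pos: "\<And>b. b \<in> reduced_alphabet Al p \<Omega> A0 i \<Longrightarrow> \<nu> b > 0"
    and \<nu>_sum: "sum \<nu> (reduced_alphabet Al p \<Omega> A0 i) = 1"
    and equilibrium: "\<And>b. b \<in> reduced_alphabet Al p \<Omega> A0 i \<Longrightarrow>
      ((1 - t) * gsum \<gamma> (i - 1) + t * gsum \<gamma> i) * ln (exp_count p \<Omega> A0 i b) = Q + gsum \<gamma> i * ln (\<nu> b)
      + (\<Sum>j=i+1..k. \<gamma> j * ln (fibre_sum (proj p i j) (reduced_alphabet Al p \<Omega> A0 i) \<nu> (proj p i j b)))"
begin

abbreviation "S \<equiv> reduced_alphabet Al p \<Omega> A0 i"
abbreviation "e \<equiv> exp_count p \<Omega> A0 i"

text \<open>Viewed from level \<open>i\<close> upwards, a ball of radius \<open>exp (- n)\<close> is a code \<open>c\<close>: its letter at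
  position \<open>l\<close> is the projection to the finest alphabet \<open>level n l \<ge> i\<close> that the ball still determines
  there. A piece \<open>(c, m, v)\<close> adds a word \<open>v\<close> over the first alphabet lying above the first \<open>m\<close> letters of
  the code, which fixes the coordinates below level \<open>i\<close> because \<open>m \<ge> len n (i - 1)\<close>. Whether the shorter or the
  longer \<open>m\<close> gives the better expected count is decided code by code.\<close>

definition level :: "nat \<Rightarrow> nat \<Rightarrow> nat" where
  "level n l = (LEAST j. i \<le> j \<and> l < len n j)"

definition weight :: "nat \<Rightarrow> 'a \<Rightarrow> real" where
  "weight j = fibre_sum (proj p i j) S \<nu>"

definition codes :: "nat \<Rightarrow> (nat \<Rightarrow> 'a) set" where
  "codes n = PiE {..<len n k} (\<lambda>l. proj p i (level n l) ` S)"

text \<open>The measure of the ball with code \<open>c\<close> under the Bernoulli measure with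
  weights \<open>\<nu>\<close>.\<close>

definition mass :: "nat \<Rightarrow> (nat \<Rightarrow> 'a) \<Rightarrow> real" where
  "mass n c = (\<Prod>l<len n k. weight (level n l) (c l))"

text \<open>This is \<open>n * (Q + \<epsilon>)\<close> up to a bounded error;
  \<open>len n k / gsum \<gamma> k\<close> stands for \<open>n\<close> because the averages are
  compared at length \<open>len n k\<close>.\<close>

definition growth :: "nat \<Rightarrow> real" where
  "growth n = real (len n k) * Q / gsum \<gamma> k + \<epsilon> * real n"

definition admissible :: "nat \<Rightarrow> (nat \<Rightarrow> 'a) \<Rightarrow> nat set" where
  "admissible n c = {m \<in> {len n (i - 1), len n i}. (\<Prod>l<m. e (c l)) \<le> mass n c * exp (growth n)}"

definition pieces :: "nat \<Rightarrow> ((nat \<Rightarrow> 'a) \<times> nat \<times> (nat \<Rightarrow> 'a)) set" where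
  "pieces n = (SIGMA c:codes n. SIGMA m:admissible n c. PiE {..<m} (\<lambda>l. {a \<in> Al 1. proj p 1 i a = c l}))"

definition live :: "nat \<Rightarrow> 'w \<Rightarrow> ((nat \<Rightarrow> 'a) \<times> nat \<times> (nat \<Rightarrow> 'a)) set" where
  "live n \<omega> = {(c, m, v) \<in> pieces n. survives m v \<omega>}"

definition region :: "nat \<Rightarrow> (nat \<Rightarrow> 'a) \<times> nat \<times> (nat \<Rightarrow> 'a) \<Rightarrow> (nat \<Rightarrow> 'a) set" where
  "region n = (\<lambda>(c, m, v). {x \<in> space (shift_space (Al 1)).
     (\<forall>l<m. x l = v l) \<and> (\<forall>l<len n k. proj p 1 (level n l) (x l) = c l)})"

lemma fin_S: "finite S"
  using finite_reduced i by simp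

lemma level:
  assumes "i \<le> j" "j \<le> k" "l < len n j"
  shows "i \<le> level n l" "level n l \<le> j" "l < len n (level n l)"
proof -
  have "i \<le> level n l \<and> l < len n (level n l)"
    unfolding level_def by (rule LeastI[of _ j]) (use assms in simp)
  then show "i \<le> level n l" "l < len n (level n l)" by auto
  show "level n l \<le> j" unfolding level_def by (rule Least_le) (use assms in simp)
qed

lemma weight_pos: "b \<in> S \<Longrightarrow> weight j (proj p i j b) > 0"
  unfolding weight_def fibre_sum_def using fin_S \<nu>_pos by (intro sum_pos) auto

lemma weight_sum: "(\<Sum>d\<in>proj p i j ` S. weight j d) = 1"
  unfolding weight_def fibre_sum_def using fin_S \<nu>_sum by (subst sum.group) auto

lemma finite_codes: "finite (codes n)"
  unfolding codes_def using fin_S by (intro finite_PiE) auto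

lemma mass_sum: "(\<Sum>c\<in>codes n. mass n c) = 1"
  unfolding codes_def mass_def using fin_S
  by (subst prod_sum_PiE[symmetric]) (auto simp: weight_sum)

lemma mass_nonneg: "c \<in> codes n \<Longrightarrow> 0 \<le> mass n c"
  unfolding mass_def codes_def
  by (intro prod_nonneg ballI) (auto simp: PiE_iff intro!: less_imp_le weight_pos dest!: bspec)

lemma finite_pieces: "finite (pieces n)"
  unfolding pieces_def using finite_codes finite_Al1
  by (intro finite_SigmaI finite_PiE) (auto simp: admissible_def)

text \<open>A code has at most two admissible lengths, each with expected count at most its mass
  times \<open>exp (growth n)\<close>, and the masses sum to 1.\<close>

lemma expected_live:
  "(\<Sum>(c, m, v)\<in>pieces n. prob {\<omega> \<in> space \<Omega>. survives m v \<omega>}) \<le> 2 * exp (growth n)"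
proof -
  have fin: "finite (admissible n c)" for c by (simp add: admissible_def)
  have card: "card (admissible n c) \<le> 2" for c
  proof -
    have "card (admissible n c) \<le> card {len n (i - 1), len n i}"
      unfolding admissible_def by (intro card_mono) auto
    also have "\<dots> \<le> 2" by (simp add: card_insert_if)
    finally show ?thesis .
  qed
  have "(\<Sum>(c, m, v)\<in>pieces n. prob {\<omega> \<in> space \<Omega>. survives m v \<omega>})
      = (\<Sum>c\<in>codes n. \<Sum>m\<in>admissible n c. \<Sum>v\<in>PiE {..<m} (\<lambda>l. {a \<in> Al 1. proj p 1 i a = c l}).
          prob {\<omega> \<in> space \<Omega>. survives m v \<omega>})"
  proof -
    let ?V = "\<lambda>c m. PiE {..<m} (\<lambda>l. {a \<in> Al 1. proj p 1 i a = c l})"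
    have finV: "finite (?V c m)" for c :: "nat \<Rightarrow> 'a" and m using finite_Al1 by (intro finite_PiE) auto
    have "(\<Sum>(c, m, v)\<in>pieces n. prob {\<omega> \<in> space \<Omega>. survives m v \<omega>})
        = (\<Sum>c\<in>codes n. \<Sum>(m, v)\<in>Sigma (admissible n c) (?V c). prob {\<omega> \<in> space \<Omega>. survives m v \<omega>})"
      unfolding pieces_def using finite_codes fin finV by (intro sum.Sigma[symmetric]) auto
    also have "\<dots> = (\<Sum>c\<in>codes n. \<Sum>m\<in>admissible n c. \<Sum>v\<in>?V c m. prob {\<omega> \<in> space \<Omega>. survives m v \<omega>})"
      using fin finV by (intro sum.cong refl sum.Sigma[symmetric]) auto
    finally show ?thesis .
  qed
  also have "\<dots> = (\<Sum>c\<in>codes n. \<Sum>m\<in>admissible n c. \<Prod>l<m. e (c l))"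
    by (simp only: expected_survivors)
  also have "\<dots> \<le> (\<Sum>c\<in>codes n. \<Sum>m\<in>admissible n c. mass n c * exp (growth n))"
    by (intro sum_mono) (simp add: admissible_def)
  also have "\<dots> \<le> (\<Sum>c\<in>codes n. 2 * exp (growth n) * mass n c)"
  proof (rule sum_mono)
    fix c assume c: "c \<in> codes n"
    have "real (card (admissible n c)) * (mass n c * exp (growth n)) \<le> 2 * (mass n c * exp (growth n))"
      using card[of c] mass_nonneg[OF c] by (intro mult_right_mono) auto
    then show "(\<Sum>m\<in>admissible n c. mass n c * exp (growth n)) \<le> 2 * exp (growth n) * mass n c"
      by (simp add: mult_ac)
  qed
  also have "\<dots> = 2 * exp (growth n)"
    by (simp add: mass_sum flip: sum_distrib_left)
  finally show ?thesis .
qed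

text \<open>Levels below \<open>i\<close> are fixed by the word \<open>v\<close>, long enough as
  \<open>m \<ge> len n (i - 1)\<close>. At a level \<open>j \<ge> i\<close> the code fixes a
  projection at least as fine as \<open>Al j\<close>.\<close>

lemma region_diam:
  assumes "P \<in> pieces n"
  shows "set_diam (sponge_dist p \<gamma> k) (region n P) \<le> ennreal (exp (- real n))"
proof -
  obtain c m v where P: "P = (c, m, v)" "m \<in> admissible n c" using assms by (auto simp: pieces_def)
  then have m: "len n (i - 1) \<le> m" using len_mono[of "i - 1" i n] i by (auto simp: admissible_def)
  have "sponge_dist p \<gamma> k x y \<le> exp (- real n)" if x: "x \<in> region n P" and y: "y \<in> region n P" for x y
  proof (rule sponge_dist_le)
    fix j l assume j: "1 \<le> j" "j \<le> k" and l: "l < nat \<lceil>real n * gsum \<gamma> j\<rceil>"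
    show "proj p 1 j (x l) = proj p 1 j (y l)"
    proof (cases "j \<le> i - 1")
      case True
      then have "len n j \<le> len n (i - 1)" using i by (intro len_mono) auto
      then have "l < m" using l[folded len_def] m by linarith
      then show ?thesis using x y by (simp add: region_def P)
    next
      case False
      then have "i \<le> j" by simp
      note lv = level[OF this j(2) l[folded len_def]]
      have "l < len n k" using l[folded len_def] len_mono[of j k n] j by linarith
      then have "proj p 1 (level n l) (x l) = proj p 1 (level n l) (y l)"
        using x y by (simp add: region_def P)
      moreover have "proj p 1 j a = proj p (level n l) j (proj p 1 (level n l) a)" for a
        using lv i by (intro proj_compose) auto
      ultimately show ?thesis by metis
    qed
  qed (use k gsum_positive in auto)
  then show ?thesis
    unfolding set_diam_def by (intro SUP_least ennreal_leI)
qed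

text \<open>The averages of these functions up to \<open>len n r\<close> add up to the logarithmic mass minus the
  interpolated expected count (\<open>ln_mass\<close>), while at a common length they cancel down to the constant
  \<open>- Q\<close> (\<open>drift_balance\<close>).\<close>

definition drift :: "nat \<Rightarrow> 'a \<Rightarrow> real" where
  "drift r b = (if r = i - 1 then - (1 - t) * ln (e b)
     else (if r \<le> k then ln (weight r (proj p i r b)) else 0)
        - (if Suc r \<le> k then ln (weight (Suc r) (proj p i (Suc r) b)) else 0)
        - (if r = i then t * ln (e b) else 0))"

text \<open>Summation by parts turns the differences of logarithmic weights into the right side of
  the Euler-Lagrange equation up to \<open>Q\<close>; the terms with \<open>1 - t\<close> and
  \<open>t\<close> form its left side.\<close>

lemma drift_balance:
  assumes b: "b \<in> S"
  shows "(\<Sum>r=i-1..k. gsum \<gamma> r * drift r b) = - Q"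
proof -
  \<comment> \<open>The value 0 beyond \<open>k\<close> makes the boundary term at
    \<open>Suc k\<close> vanish.\<close>
  define u where "u r = (if r \<le> k then ln (weight r (proj p i r b)) else 0)" for r
  have "{b' \<in> S. b' = b} = {b}" using b by auto
  then have ui: "u i = ln (\<nu> b)" using i by (simp add: u_def weight_def fibre_sum_def)
  have "(\<Sum>r=i-1..k. gsum \<gamma> r * drift r b)
      = gsum \<gamma> (i - 1) * (- (1 - t) * ln (e b)) + (\<Sum>r=i..k. gsum \<gamma> r * drift r b)"
    using i by (subst sum.atLeast_Suc_atMost) (auto simp: drift_def)
  also have "(\<Sum>r=i..k. gsum \<gamma> r * drift r b)
      = (\<Sum>r=i..k. gsum \<gamma> r * (u r - u (Suc r)) - (if r = i then gsum \<gamma> i * (t * ln (e b)) else 0))"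
    using i by (intro sum.cong) (auto simp: drift_def u_def algebra_simps)
  also have "\<dots> = (\<Sum>r=i..k. gsum \<gamma> r * (u r - u (Suc r))) - gsum \<gamma> i * (t * ln (e b))"
    using i by (simp add: sum_subtractf)
  also have "(\<Sum>r=i..k. gsum \<gamma> r * (u r - u (Suc r)))
      = gsum \<gamma> i * u i + (\<Sum>j=Suc i..k. (gsum \<gamma> j - gsum \<gamma> (j - 1)) * u j) - gsum \<gamma> k * u (Suc k)"
    by (rule sum_by_parts[OF i(2)])
  also have "u (Suc k) = 0" by (simp add: u_def)
  also have "(\<Sum>j=Suc i..k. (gsum \<gamma> j - gsum \<gamma> (j - 1)) * u j)
      = (\<Sum>j=i+1..k. \<gamma> j * ln (fibre_sum (proj p i j) S \<nu> (proj p i j b)))"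
  proof (intro sum.cong)
    fix j assume j: "j \<in> {i+1..k}"
    then obtain j' where "j = Suc j'" by (cases j) auto
    then show "(gsum \<gamma> j - gsum \<gamma> (j - 1)) * u j = \<gamma> j * ln (fibre_sum (proj p i j) S \<nu> (proj p i j b))"
      using j by (simp add: gsum_Suc u_def weight_def)
  qed simp
  finally show ?thesis using equilibrium[OF b] ui by (simp add: algebra_simps)
qed

text \<open>Position \<open>l\<close> contributes at \<open>level n l\<close>; telescoping over the coarser levels rewrites the
  mass in terms of the full sums of each level up to its own length.\<close>

lemma ln_mass:
  assumes b: "\<And>l. b l \<in> S"
  shows "(\<Sum>r=i-1..k. \<Sum>l<len n r. drift r (b l))
    = ln (\<Prod>l<len n k. weight (level n l) (proj p i (level n l) (b l)))
      - (1 - t) * (\<Sum>l<len n (i - 1). ln (e (b l))) - t * (\<Sum>l<len n i. ln (e (b l)))"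
proof -
  define u where "u r l = (if r \<le> k then ln (weight r (proj p i r (b l))) else 0)" for r l
  have tel: "ln (weight (level n l) (proj p i (level n l) (b l)))
      = (\<Sum>r=i..k. if l < len n r then u r l - u (Suc r) l else 0)" if l: "l < len n k" for l
  proof -
    note lv = level[OF i(2) order.refl l]
    have "(\<Sum>r=i..k. if l < len n r then u r l - u (Suc r) l else 0)
        = (\<Sum>r\<in>{r \<in> {i..k}. l < len n r}. u r l - u (Suc r) l)"
      by (rule sum.inter_filter[symmetric]) simp
    \<comment> \<open>Since \<open>len n\<close> is monotone, the levels that reach position
      \<open>l\<close> form a final segment starting at \<open>level n l\<close>.\<close>
    also have "{r \<in> {i..k}. l < len n r} = {level n l..k}"
    proof (intro equalityI subsetI)
      fix r assume "r \<in> {level n l..k}"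
      then show "r \<in> {r \<in> {i..k}. l < len n r}"
        using lv len_mono[of "level n l" r n] by auto
    qed (use level(2) in auto)
    also have "(\<Sum>r=level n l..k. u r l - u (Suc r) l) = u (level n l) l - u (Suc k) l"
      using lv(2) sum_Suc_diff[of "level n l" k "\<lambda>r. - u r l"] by (simp add: algebra_simps)
    finally show ?thesis using lv(2) by (simp add: u_def)
  qed
  have "ln (\<Prod>l<len n k. weight (level n l) (proj p i (level n l) (b l)))
      = (\<Sum>l<len n k. ln (weight (level n l) (proj p i (level n l) (b l))))"
    using weight_pos[OF b] by (intro ln_prod) (auto simp: less_imp_neq[symmetric])
  also have "\<dots> = (\<Sum>l<len n k. \<Sum>r=i..k. if l < len n r then u r l - u (Suc r) l else 0)"
    by (intro sum.cong tel) auto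
  also have "\<dots> = (\<Sum>r=i..k. \<Sum>l<len n k. if l < len n r then u r l - u (Suc r) l else 0)"
    by (rule sum.swap)
  also have "\<dots> = (\<Sum>r=i..k. \<Sum>l<len n r. u r l - u (Suc r) l)"
  proof (rule sum.cong[OF refl])
    fix r assume "r \<in> {i..k}"
    then have "{l \<in> {..<len n k}. l < len n r} = {..<len n r}" using len_mono[of r k n] by auto
    then show "(\<Sum>l<len n k. if l < len n r then u r l - u (Suc r) l else 0) = (\<Sum>l<len n r. u r l - u (Suc r) l)"
      by (simp flip: sum.inter_filter)
  qed
  finally have mass: "ln (\<Prod>l<len n k. weight (level n l) (proj p i (level n l) (b l)))
      = (\<Sum>r=i..k. \<Sum>l<len n r. u r l - u (Suc r) l)" .
  have "(\<Sum>r=i-1..k. \<Sum>l<len n r. drift r (b l))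
      = (\<Sum>l<len n (i - 1). - (1 - t) * ln (e (b l))) + (\<Sum>r=i..k. \<Sum>l<len n r. drift r (b l))"
    using i by (subst sum.atLeast_Suc_atMost) (auto simp: drift_def)
  also have "(\<Sum>r=i..k. \<Sum>l<len n r. drift r (b l))
      = (\<Sum>r=i..k. (\<Sum>l<len n r. u r l - u (Suc r) l) - (if r = i then t * (\<Sum>l<len n i. ln (e (b l))) else 0))"
  proof (rule sum.cong[OF refl])
    fix r assume r: "r \<in> {i..k}"
    have "(\<Sum>l<len n r. drift r (b l)) = (\<Sum>l<len n r. (u r l - u (Suc r) l) - (if r = i then t * ln (e (b l)) else 0))"
      using r i by (intro sum.cong refl) (auto simp: drift_def u_def)
    also have "\<dots> = (\<Sum>l<len n r. u r l - u (Suc r) l) - (if r = i then t * (\<Sum>l<len n i. ln (e (b l))) else 0)"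
      by (subst sum_subtractf) (simp add: sum_distrib_left)
    finally show "(\<Sum>l<len n r. drift r (b l))
        = (\<Sum>l<len n r. u r l - u (Suc r) l) - (if r = i then t * (\<Sum>l<len n i. ln (e (b l))) else 0)" .
  qed
  also have "\<dots> = (\<Sum>r=i..k. \<Sum>l<len n r. u r l - u (Suc r) l) - t * (\<Sum>l<len n i. ln (e (b l)))"
    using i by (simp add: sum_subtractf[of _ _ "{i..k}"])
  finally show ?thesis unfolding mass sum_distrib_left[symmetric] by (simp only: left_diff_distrib minus_mult_left[symmetric])
qed

text \<open>For infinitely many \<open>n\<close> the averaging lemma bounds the interpolated
  logarithmic count by the logarithmic mass plus \<open>growth n\<close>. One of the two lengths is
  then admissible, and the corresponding prefix of \<open>x\<close> is a live piece.\<close>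

lemma region_cover:
  assumes x: "x \<in> sponge (Al 1) A \<omega>"
    and pos: "\<forall>u\<in>lists (Al 1). \<forall>a. a \<in> A u \<omega> \<longrightarrow> a \<in> Al 1 \<and> letter_prob a > 0"
  shows "\<exists>n\<ge>N. x \<in> \<Union>(region n ` live n \<omega>)"
proof -
  have x1: "x \<in> space (shift_space (Al 1))" and xA: "\<And>l. x l \<in> A (map x [0..<l]) \<omega>"
    using x by (auto simp: sponge_def sponge_level_def)
  have xl: "x l \<in> Al 1" for l using x1 by (simp add: space_shift_space)
  have "map x [0..<l] \<in> lists (Al 1)" for l using xl by auto
  then have xpos: "letter_prob (x l) > 0" for l using pos xA by blast
  define b where "b l = proj p 1 i (x l)" for l
  have b: "b l \<in> S" for l unfolding b_def using i xl xpos by (intro proj_in_reduced) auto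
  have bj: "proj p 1 j (x l) = proj p i j (b l)" if "i \<le> j" for j l
    unfolding b_def using i that by (intro proj_compose) auto
  have e_pos: "e (b l) > 0" for l using b by (simp add: reduced_alphabet_def)
  define C where "C = (\<Sum>r=i-1..k. \<Sum>b\<in>S. \<bar>gsum \<gamma> r * drift r b\<bar>)"
  \<comment> \<open>The factor \<open>gsum \<gamma> r\<close> cancels at the scale of level
    \<open>r\<close>, leaving the sums in \<open>ln_mass\<close>; at the common scale of level
    \<open>k\<close> it produces the combination in \<open>drift_balance\<close>.\<close>
  obtain n where n: "n \<ge> N" and avg: "- \<epsilon> * real n \<le> (\<Sum>r=i-1..k.
      (\<Sum>l<nat \<lceil>real n * gsum \<gamma> r\<rceil>. gsum \<gamma> r * drift r (b l)) / gsum \<gamma> r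
      - (\<Sum>l<nat \<lceil>real n * gsum \<gamma> k\<rceil>. gsum \<gamma> r * drift r (b l)) / gsum \<gamma> k)"
  proof (rule scaled_averages[of "{i-1..k}" "\<lambda>r l. gsum \<gamma> r * drift r (b l)" C "gsum \<gamma>" "gsum \<gamma> k" \<epsilon> N])
    fix r l assume r: "r \<in> {i-1..k}"
    have "\<bar>gsum \<gamma> r * drift r (b l)\<bar> \<le> (\<Sum>b\<in>S. \<bar>gsum \<gamma> r * drift r b\<bar>)"
      using b fin_S by (intro member_le_sum) auto
    also have "\<dots> \<le> C" unfolding C_def using r by (intro member_le_sum) (auto intro: sum_nonneg)
    finally show "\<bar>gsum \<gamma> r * drift r (b l)\<bar> \<le> C" .
  qed (use i k \<epsilon> gsum_positive in auto)
  define c where "c = (\<lambda>l\<in>{..<len n k}. proj p i (level n l) (b l))"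
  have c: "c \<in> codes n" using b by (auto simp: c_def codes_def)
  have mass_c: "mass n c = (\<Prod>l<len n k. weight (level n l) (proj p i (level n l) (b l)))"
    unfolding mass_def by (intro prod.cong) (auto simp: c_def)
  then have mass_pos: "mass n c > 0" using weight_pos[OF b] by (auto intro: prod_pos)
  have "(\<Sum>r=i-1..k. (\<Sum>l<nat \<lceil>real n * gsum \<gamma> r\<rceil>. gsum \<gamma> r * drift r (b l)) / gsum \<gamma> r)
      = (\<Sum>r=i-1..k. \<Sum>l<len n r. drift r (b l))"
  proof (intro sum.cong refl)
    fix r assume "r \<in> {i-1..k}"
    then have "gsum \<gamma> r > 0" using i by (intro gsum_positive) auto
    then show "(\<Sum>l<nat \<lceil>real n * gsum \<gamma> r\<rceil>. gsum \<gamma> r * drift r (b l)) / gsum \<gamma> r = (\<Sum>l<len n r. drift r (b l))"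
      by (simp add: len_def flip: sum_distrib_left)
  qed
  moreover have "(\<Sum>r=i-1..k. (\<Sum>l<nat \<lceil>real n * gsum \<gamma> k\<rceil>. gsum \<gamma> r * drift r (b l)) / gsum \<gamma> k)
      = (\<Sum>l<len n k. \<Sum>r=i-1..k. gsum \<gamma> r * drift r (b l)) / gsum \<gamma> k"
    unfolding sum_divide_distrib[symmetric] len_def by (subst sum.swap) simp
  moreover have "(\<Sum>l<len n k. \<Sum>r=i-1..k. gsum \<gamma> r * drift r (b l)) = - (real (len n k) * Q)"
    unfolding drift_balance[OF b] by simp
  ultimately have "- \<epsilon> * real n \<le> (\<Sum>r=i-1..k. \<Sum>l<len n r. drift r (b l)) + real (len n k) * Q / gsum \<gamma> k"
    using avg by (simp add: sum_subtractf)
  then have key: "(1 - t) * (\<Sum>l<len n (i - 1). ln (e (b l))) + t * (\<Sum>l<len n i. ln (e (b l)))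
      \<le> ln (mass n c) + growth n"
    unfolding ln_mass[OF b] mass_c growth_def by simp
  \<comment> \<open>A convex combination that is at most a bound has at least one member that is at
    most this bound.\<close>
  have "\<exists>m\<in>{len n (i - 1), len n i}. (\<Sum>l<m. ln (e (b l))) \<le> ln (mass n c) + growth n"
  proof (rule ccontr)
    assume "\<not> ?thesis"
    then have *: "(\<Sum>l<len n (i - 1). ln (e (b l))) > ln (mass n c) + growth n"
      "(\<Sum>l<len n i. ln (e (b l))) > ln (mass n c) + growth n" by auto
    have "(1 - t) * (\<Sum>l<len n (i - 1). ln (e (b l))) + t * (\<Sum>l<len n i. ln (e (b l)))
        > ln (mass n c) + growth n"
    \<comment> \<open>For \<open>t = 1\<close> the first term vanishes and strictness comes from the
      second.\<close>
    proof (cases "t = 1")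
      case False
      have "(1 - t) * (ln (mass n c) + growth n) < (1 - t) * (\<Sum>l<len n (i - 1). ln (e (b l)))"
        using False t *(1) by (intro mult_strict_left_mono) auto
      moreover have "t * (ln (mass n c) + growth n) \<le> t * (\<Sum>l<len n i. ln (e (b l)))"
        using t *(2) by (intro mult_left_mono) auto
      ultimately show ?thesis by (simp add: algebra_simps)
    qed (use * in simp)
    then show False using key by simp
  qed
  then obtain m where m: "m \<in> {len n (i - 1), len n i}" and sm: "(\<Sum>l<m. ln (e (b l))) \<le> ln (mass n c) + growth n" by blast
  have m_le: "m \<le> len n i" using m len_mono[of "i - 1" i n] i by auto
  \<comment> \<open>Positions below \<open>len n i\<close> have level \<open>i\<close>, so there the
    code consists of the letters \<open>b l\<close> themselves.\<close>
  have cl: "c l = b l" if "l < m" for l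
  proof -
    have "l < len n i" using that m_le by simp
    moreover have "len n i \<le> len n k" using i by (intro len_mono) auto
    moreover have "level n l = i"
      using level[OF order.refl i(2)] \<open>l < len n i\<close> by (metis le_antisym)
    ultimately show ?thesis by (simp add: c_def)
  qed
  have "(\<Prod>l<m. e (c l)) = exp (\<Sum>l<m. ln (e (b l)))"
    using cl e_pos by (simp add: exp_sum)
  also have "\<dots> \<le> exp (ln (mass n c) + growth n)" using sm by simp
  also have "\<dots> = mass n c * exp (growth n)" using mass_pos by (simp add: exp_add)
  finally have adm: "m \<in> admissible n c" using m by (simp add: admissible_def)
  define v where "v = restrict x {..<m}"
  have "(c, m, v) \<in> pieces n"
    unfolding pieces_def using c adm cl xl by (auto simp: v_def b_def)
  moreover have "survives m v \<omega>"
    unfolding survives_def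
  proof (intro allI impI)
    fix l assume l: "l < m"
    then have "map v [0..<l] = map x [0..<l]" by (auto simp: v_def)
    moreover have "v l = x l" using l by (simp add: v_def)
    ultimately show "v l \<in> A (map v [0..<l]) \<omega>" using xA[of l] by metis
  qed
  ultimately have "(c, m, v) \<in> live n \<omega>" by (simp add: live_def)
  moreover have "x \<in> region n (c, m, v)"
    unfolding region_def using x1 bj level(1)[OF i(2) order.refl] by (auto simp: v_def c_def)
  ultimately show ?thesis using n by blast
qed

text \<open>By \<open>expected_live\<close> the expected value of the series is dominated by a
  geometric series of ratio \<open>exp (Q + \<epsilon> - s) < 1\<close>; a nonnegative series with
  finite expectation converges almost surely.\<close>

lemma AE_live_summable:
  assumes s: "s > Q + \<epsilon>"
  shows "AE \<omega> in \<Omega>. summable (\<lambda>n. real (card (live n \<omega>)) * exp (- s * real n))"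
proof -
  define g where "g = gsum \<gamma> k"
  have g: "g > 0" unfolding g_def using k by (intro gsum_positive) auto
  define E :: "(nat \<Rightarrow> 'a) \<times> nat \<times> (nat \<Rightarrow> 'a) \<Rightarrow> 'w set"
    where "E = (\<lambda>(c, m, v). {\<omega> \<in> space \<Omega>. survives m v \<omega>})"
  have E: "E P \<in> events" if "P \<in> pieces n" for P n
  proof -
    obtain c m v where P: "P = (c, m, v)" by (cases P) auto
    then have "v \<in> {..<m} \<rightarrow> Al 1" using that by (auto simp: pieces_def PiE_iff)
    then show ?thesis by (simp add: P E_def survives_event_prob(1))
  qed
  define w where "w n \<omega> = ennreal (exp (- s * real n)) * (\<Sum>P\<in>pieces n. indicator (E P) \<omega>)" for n and \<omega>
  have w_meas: "w n \<in> borel_measurable \<Omega>" for n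
    unfolding w_def using E by (intro borel_measurable_times_ennreal borel_measurable_sum) auto
  have w_eq: "w n \<omega> = ennreal (real (card (live n \<omega>)) * exp (- s * real n))" if "\<omega> \<in> space \<Omega>" for n \<omega>
  proof -
    have "(\<Sum>P\<in>pieces n. indicator (E P) \<omega> :: ennreal) = of_nat (card {P \<in> pieces n. \<omega> \<in> E P})"
      using finite_pieces by (simp add: indicator_def sum.If_cases Int_def)
    also have "{P \<in> pieces n. \<omega> \<in> E P} = live n \<omega>"
      using that by (auto simp: live_def E_def)
    finally show ?thesis
      by (simp add: w_def ennreal_mult ennreal_of_nat_eq_real_of_nat mult.commute)
  qed
  define B where "B n = exp (- s * real n) * (2 * exp (growth n))" for n
  have w_int: "(\<integral>\<^sup>+ \<omega>. w n \<omega> \<partial>\<Omega>) \<le> ennreal (B n)" for n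
  proof -
    have "(\<integral>\<^sup>+ \<omega>. w n \<omega> \<partial>\<Omega>) = ennreal (exp (- s * real n)) * (\<Sum>P\<in>pieces n. emeasure \<Omega> (E P))"
      unfolding w_def using E
      by (subst nn_integral_cmult) (auto simp: nn_integral_sum intro!: borel_measurable_sum)
    also have "(\<Sum>P\<in>pieces n. emeasure \<Omega> (E P)) = ennreal (\<Sum>P\<in>pieces n. prob (E P))"
      by (simp add: emeasure_eq_measure sum_ennreal)
    also have "(\<Sum>P\<in>pieces n. prob (E P)) = (\<Sum>(c, m, v)\<in>pieces n. prob {\<omega> \<in> space \<Omega>. survives m v \<omega>})"
      by (intro sum.cong) (auto simp: E_def)
    also have "ennreal (exp (- s * real n)) * ennreal \<dots> \<le> ennreal (exp (- s * real n)) * ennreal (2 * exp (growth n))"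
      by (intro mult_left_mono ennreal_leI expected_live) auto
    finally show ?thesis by (simp add: B_def ennreal_mult)
  qed
  \<comment> \<open>Rounding in \<open>len n k\<close> costs at most the constant
    \<open>\<bar>Q\<bar> / g\<close>.\<close>
  have growth_le: "growth n \<le> \<bar>Q\<bar> / g + (Q + \<epsilon>) * real n" for n
  proof -
    have "\<bar>real (len n k) - real n * g\<bar> \<le> 1"
      using g unfolding len_def g_def by (simp add: abs_le_iff) linarith
    then have "\<bar>(real (len n k) - real n * g) * Q\<bar> \<le> 1 * \<bar>Q\<bar>"
      unfolding abs_mult by (intro mult_right_mono) auto
    then have "(real (len n k) - real n * g) * Q \<le> \<bar>Q\<bar>" by linarith
    then have "(real (len n k) - real n * g) * Q / g \<le> \<bar>Q\<bar> / g"
      using g by (intro divide_right_mono) auto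
    moreover have "(real (len n k) - real n * g) * Q / g = real (len n k) * Q / g - real n * Q"
      using g by (simp add: field_simps)
    ultimately show ?thesis by (simp add: growth_def g_def algebra_simps)
  qed
  define q where "q = exp (Q + \<epsilon> - s)"
  have q: "0 \<le> q" "q < 1" using s by (auto simp: q_def)
  have B_le: "B n \<le> 2 * exp (\<bar>Q\<bar> / g) * q ^ n" for n
  proof -
    have "B n = 2 * exp (growth n - s * real n)" by (simp add: B_def flip: exp_add)
    also have "\<dots> \<le> 2 * exp (\<bar>Q\<bar> / g + (Q + \<epsilon> - s) * real n)"
      using growth_le[of n] by (simp add: algebra_simps)
    also have "\<dots> = 2 * exp (\<bar>Q\<bar> / g) * q ^ n"
      by (simp add: q_def exp_add exp_of_nat_mult[symmetric] mult.commute)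
    finally show ?thesis .
  qed
  have B0: "0 \<le> B n" for n by (simp add: B_def)
  have "summable B"
  proof (rule summable_comparison_test')
    show "summable (\<lambda>n. 2 * exp (\<bar>Q\<bar> / g) * q ^ n)" using q by (intro summable_mult summable_geometric) auto
    show "norm (B n) \<le> 2 * exp (\<bar>Q\<bar> / g) * q ^ n" if "n \<ge> 0" for n
      using B_le[of n] by (simp add: B_def)
  qed
  have "(\<integral>\<^sup>+ \<omega>. (\<Sum>n. w n \<omega>) \<partial>\<Omega>) = (\<Sum>n. \<integral>\<^sup>+ \<omega>. w n \<omega> \<partial>\<Omega>)"
    by (rule nn_integral_suminf) (rule w_meas)
  also have "\<dots> \<le> (\<Sum>n. ennreal (B n))" by (intro suminf_le w_int) auto
  also have "\<dots> = ennreal (\<Sum>n. B n)" by (rule suminf_ennreal2[OF B0 \<open>summable B\<close>])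
  finally have "(\<integral>\<^sup>+ \<omega>. (\<Sum>n. w n \<omega>) \<partial>\<Omega>) \<noteq> \<infinity>" by (auto simp: top_unique)
  then have "AE \<omega> in \<Omega>. (\<Sum>n. w n \<omega>) \<noteq> \<infinity>"
    using w_meas by (intro nn_integral_PInf_AE) auto
  moreover have "AE \<omega> in \<Omega>. \<omega> \<in> space \<Omega>" by (rule AE_space)
  ultimately show ?thesis
  proof eventually_elim
    case (elim \<omega>)
    then show ?case
      using w_eq by (intro summable_suminf_not_top) auto
  qed
qed

lemma AE_dim_le_of_equilibrium:
  assumes s: "s > Q + \<epsilon>"
  shows "AE \<omega> in \<Omega>. sponge (Al 1) A \<omega> \<noteq> {} \<longrightarrow>
    hausdorff_dim (space (shift_space (Al 1))) (sponge_dist p \<gamma> k) (sponge (Al 1) A \<omega>) \<le> ereal s"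
  using AE_live_summable[OF s] AE_letters_positive
proof eventually_elim
  case (elim \<omega>)
  define \<U> where "\<U> n = region n ` live n \<omega>" for n
  have fin_live: "finite (live n \<omega>)" for n
    by (rule finite_subset[OF _ finite_pieces[of n]]) (auto simp: live_def)
  have fin: "finite (\<U> n)" for n unfolding \<U>_def using fin_live by simp
  have cover: "\<exists>n\<ge>N. x \<in> \<Union>(\<U> n)" if "x \<in> sponge (Al 1) A \<omega>" for x N
    unfolding \<U>_def by (rule region_cover[OF that elim(2)])
  have summ: "summable (\<lambda>n. real (card (\<U> n)) * exp (- s * real n))"
  proof (rule summable_comparison_test'[OF elim(1)])
    show "norm (real (card (\<U> n)) * exp (- s * real n)) \<le> real (card (live n \<omega>)) * exp (- s * real n)" for n
      unfolding \<U>_def using card_image_le[OF fin_live] by (simp add: mult_right_mono)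
  qed
  show ?case
  proof
    assume "sponge (Al 1) A \<omega> \<noteq> {}"
    then obtain x where "x \<in> sponge (Al 1) A \<omega>" by blast
    \<comment> \<open>A point of the sponge excludes \<open>s \<le> 0\<close>, since it lies in
      infinitely many cover families.\<close>
    then have "s > 0" using cover_exponent_pos[OF fin cover summ] by blast
    then show "hausdorff_dim (space (shift_space (Al 1))) (sponge_dist p \<gamma> k) (sponge (Al 1) A \<omega>) \<le> ereal s"
    proof (intro hausdorff_dim_le_of_covers[of \<U>, OF fin _ _ cover summ])
      show "U \<subseteq> space (shift_space (Al 1))" if "U \<in> \<U> n" for U n
        using that by (auto simp: \<U>_def region_def)
      show "set_diam (sponge_dist p \<gamma> k) U \<le> ennreal (exp (- real n))" if "U \<in> \<U> n" for U n
        using that region_diam by (auto simp: \<U>_def live_def)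
    qed
  qed
qed

end

section \<open>Comparison with the pressure\<close>

text \<open>Integrating the Euler-Lagrange equation against \<open>\<nu>\<close> isolates
  \<open>Q\<close>: the logarithmic terms become minus the entropy expressions for the Bernoulli
  measure and its factors. Lower bounds for the entropies suffice since they enter with nonnegative
  coefficients.\<close>

lemma pressure_ge:
  fixes \<nu> :: "'a \<Rightarrow> real"
  assumes i: "1 \<le> i" "i \<le> k"
    and \<nu>_pos: "\<And>b. b \<in> S i \<Longrightarrow> \<nu> b > 0" and \<nu>_sum: "sum \<nu> (S i) = 1"
    and equilibrium: "\<And>b. b \<in> S i \<Longrightarrow>
      \<theta> * gsum \<gamma> i * ln (exp_count p \<Omega> A0 i b) = Q + gsum \<gamma> i * ln (\<nu> b)
      + (\<Sum>j=i+1..k. \<gamma> j * ln (fibre_sum (proj p i j) (S i) \<nu> (proj p i j b)))"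
  shows "ereal Q \<le> pressure Al p \<gamma> k \<Omega> A0 i \<theta>"
proof -
  have fin: "finite (S i)" using finite_reduced i by simp
  have \<nu>0: "0 \<le> \<nu> b" if "b \<in> S i" for b using \<nu>_pos[OF that] by simp
  let ?M = "bernoulli (S i) \<nu>"
  let ?w = "\<lambda>j b. fibre_sum (proj p i j) (S i) \<nu> (proj p i j b)"
  have factor: "ereal (- (\<Sum>b\<in>S i. \<nu> b * ln (?w j b)))
      \<le> ks_entropy (distr ?M (shift_space (Al j)) (proj_seq p i j)) shift" if "i \<le> j" "j \<le> k" for j
  proof -
    have "proj p i j ` S i \<subseteq> Al j" using proj_in i that by (auto simp: reduced_alphabet_def)
    then show ?thesis
      using ks_entropy_bernoulli_factor_ge[OF fin \<nu>0 \<nu>_sum, of "Al j" "proj p i j"] alphabets[of j] i that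
      by (simp add: fibre_sum_def proj_seq_def[abs_def])
  qed
  \<comment> \<open>The identity is a letter map, so the bound for factors also covers the measure
    itself.\<close>
  have self: "ereal (- (\<Sum>b\<in>S i. \<nu> b * ln (\<nu> b))) \<le> ks_entropy ?M shift"
  proof -
    have "distr ?M (shift_space (S i)) (\<lambda>x n. x n) = ?M"
      using sets_bernoulli[OF fin \<nu>0 \<nu>_sum] by (intro distr_id2) simp
    moreover have "sum \<nu> {b' \<in> S i. b' = b} = \<nu> b" if "b \<in> S i" for b
    proof -
      have "{b' \<in> S i. b' = b} = {b}" using that by auto
      then show ?thesis by simp
    qed
    ultimately show ?thesis
      using ks_entropy_bernoulli_factor_ge[OF fin \<nu>0 \<nu>_sum fin, of "\<lambda>b. b"] by simp
  qed
  have "\<theta> * (\<integral>x. potential p \<gamma> \<Omega> A0 i x \<partial>?M)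
      = (\<Sum>b\<in>S i. \<nu> b * (\<theta> * gsum \<gamma> i * ln (exp_count p \<Omega> A0 i b)))"
    unfolding potential_def
    by (subst integral_bernoulli[OF fin \<nu>0 \<nu>_sum]) (auto simp: sum_distrib_left mult_ac)
  also have "\<dots> = (\<Sum>b\<in>S i. \<nu> b * (Q + gsum \<gamma> i * ln (\<nu> b) + (\<Sum>j=i+1..k. \<gamma> j * ln (?w j b))))"
    by (rule sum.cong[OF refl]) (simp only: equilibrium)
  also have "\<dots> = Q + gsum \<gamma> i * (\<Sum>b\<in>S i. \<nu> b * ln (\<nu> b))
      + (\<Sum>b\<in>S i. \<Sum>j=i+1..k. \<gamma> j * (\<nu> b * ln (?w j b)))"
    using \<nu>_sum sum_distrib_left[of Q \<nu> "S i"] by (simp add: distrib_left sum.distrib sum_distrib_left mult_ac)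
  also have "(\<Sum>b\<in>S i. \<Sum>j=i+1..k. \<gamma> j * (\<nu> b * ln (?w j b)))
      = (\<Sum>j=i+1..k. \<gamma> j * (\<Sum>b\<in>S i. \<nu> b * ln (?w j b)))"
    by (subst sum.swap) (simp add: sum_distrib_left)
  finally have "Q = \<theta> * (\<integral>x. potential p \<gamma> \<Omega> A0 i x \<partial>?M)
      + gsum \<gamma> i * - (\<Sum>b\<in>S i. \<nu> b * ln (\<nu> b))
      + (\<Sum>j=i+1..k. \<gamma> j * - (\<Sum>b\<in>S i. \<nu> b * ln (?w j b)))"
    by (simp add: sum_negf)
  then have "ereal Q = ereal (\<theta> * (\<integral>x. potential p \<gamma> \<Omega> A0 i x \<partial>?M))
      + ereal (gsum \<gamma> i) * ereal (- (\<Sum>b\<in>S i. \<nu> b * ln (\<nu> b)))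
      + (\<Sum>j=i+1..k. ereal (\<gamma> j) * ereal (- (\<Sum>b\<in>S i. \<nu> b * ln (?w j b))))"
    by simp
  also have "\<dots> \<le> ereal (\<theta> * (\<integral>x. potential p \<gamma> \<Omega> A0 i x \<partial>?M))
      + ereal (gsum \<gamma> i) * ks_entropy ?M shift
      + (\<Sum>j=i+1..k. ereal (\<gamma> j) * ks_entropy (distr ?M (shift_space (Al j)) (proj_seq p i j)) shift)"
    using gsum_positive[OF i] gamma_pos i
    by (intro add_mono order.refl sum_mono ereal_mult_left_mono self factor) (auto intro: less_imp_le)
  also have "\<dots> \<le> pressure Al p \<gamma> k \<Omega> A0 i \<theta>"
    unfolding pressure_def
    by (rule SUP_upper) (use bernoulli_invariant[OF fin \<nu>0 \<nu>_sum] in simp)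
  finally show ?thesis .
qed

lemma AE_dim_le_pressure:
  assumes i: "2 \<le> i" "i \<le> k" and \<theta>: "theta_min \<gamma> i \<le> \<theta>" "\<theta> \<le> 1"
  shows "AE \<omega> in \<Omega>. sponge (Al 1) A \<omega> \<noteq> {} \<longrightarrow>
    hausdorff_dim (space (shift_space (Al 1))) (sponge_dist p \<gamma> k) (sponge (Al 1) A \<omega>)
      \<le> pressure Al p \<gamma> k \<Omega> A0 i \<theta>"
proof -
  let ?S = "reduced_alphabet Al p \<Omega> A0 i"
  define g where "g = gsum \<gamma> i"
  define h where "h = gsum \<gamma> (i - 1)"
  have g: "g > 0" unfolding g_def using i by (intro gsum_positive) auto
  have gh: "g = h + \<gamma> i" using gsum_Suc[of \<gamma> "i - 1"] i by (simp add: g_def h_def)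
  then have gh': "g - h > 0" using gamma_pos[of i] i by simp
  \<comment> \<open>Chosen so that \<open>(1 - t) * h + t * g = \<theta> * g\<close>; the range from
    \<open>theta_min \<gamma> i\<close> to 1 for \<open>\<theta>\<close> corresponds to the range
    from 0 to 1 for \<open>t\<close>.\<close>
  define t where "t = (\<theta> * g - h) / (g - h)"
  have "h \<le> \<theta> * g" using \<theta>(1) g by (simp add: theta_min_def g_def h_def pos_divide_le_eq)
  moreover have "\<theta> * g \<le> g" using \<theta>(2) g by simp
  ultimately have t: "0 \<le> t" "t \<le> 1" using gh' by (simp_all add: t_def)
  have "h + t * (g - h) = \<theta> * g" using gh' by (simp add: t_def)
  then have t_eq: "(1 - t) * h + t * g = \<theta> * g" by (simp add: algebra_simps)
  have "\<exists>\<nu> Q. (\<forall>b\<in>?S. \<nu> b > 0) \<and> sum \<nu> ?S = 1 \<and>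
      (\<forall>b\<in>?S. gsum \<gamma> i * (\<theta> * ln (exp_count p \<Omega> A0 i b)) = Q + gsum \<gamma> i * ln (\<nu> b)
        + (\<Sum>j=i+1..k. \<gamma> j * ln (fibre_sum (proj p i j) ?S \<nu> (proj p i j b))))"
    using i by (intro weighted_equilibrium gamma_pos finite_reduced reduced_nonempty) auto
  then obtain \<nu> Q where \<nu>: "\<And>b. b \<in> ?S \<Longrightarrow> \<nu> b > 0" "sum \<nu> ?S = 1"
    and eq: "\<And>b. b \<in> ?S \<Longrightarrow> gsum \<gamma> i * (\<theta> * ln (exp_count p \<Omega> A0 i b)) = Q + gsum \<gamma> i * ln (\<nu> b)
      + (\<Sum>j=i+1..k. \<gamma> j * ln (fibre_sum (proj p i j) ?S \<nu> (proj p i j b)))"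
    by blast
  have "ereal Q \<le> pressure Al p \<gamma> k \<Omega> A0 i \<theta>"
  proof (rule pressure_ge[OF _ i(2) \<nu>])
    fix b assume "b \<in> ?S"
    from eq[OF this, symmetric] show "\<theta> * gsum \<gamma> i * ln (exp_count p \<Omega> A0 i b) = Q + gsum \<gamma> i * ln (\<nu> b)
      + (\<Sum>j=i+1..k. \<gamma> j * ln (fibre_sum (proj p i j) ?S \<nu> (proj p i j b)))"
      by (simp only: mult.assoc mult.left_commute)
  qed (use i in auto)
  have eq': "((1 - t) * gsum \<gamma> (i - 1) + t * gsum \<gamma> i) * ln (exp_count p \<Omega> A0 i b) = Q + gsum \<gamma> i * ln (\<nu> b)
      + (\<Sum>j=i+1..k. \<gamma> j * ln (fibre_sum (proj p i j) ?S \<nu> (proj p i j b)))" if "b \<in> ?S" for b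
    unfolding eq[OF that, symmetric] using t_eq by (simp add: g_def h_def)
  let ?dim = "\<lambda>\<omega>. hausdorff_dim (space (shift_space (Al 1))) (sponge_dist p \<gamma> k) (sponge (Al 1) A \<omega>)"
  \<comment> \<open>The averaging loss is \<open>1 / Suc r\<close> and the exponent exceeds
    \<open>Q\<close> by twice that; countably many values of \<open>r\<close> give a common null
    set.\<close>
  have "AE \<omega> in \<Omega>. sponge (Al 1) A \<omega> \<noteq> {} \<longrightarrow> ?dim \<omega> \<le> ereal (Q + 2 / real (Suc r))" for r
    by (rule AE_dim_le_of_equilibrium[of i t "1 / real (Suc r)" \<nu> Q]) (use i t \<nu> eq' in \<open>auto simp: field_simps\<close>)
  then have "AE \<omega> in \<Omega>. \<forall>r. sponge (Al 1) A \<omega> \<noteq> {} \<longrightarrow> ?dim \<omega> \<le> ereal (Q + 2 / real (Suc r))"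
    unfolding AE_all_countable by blast
  then show ?thesis
  proof eventually_elim
    case (elim \<omega>)
    show ?case
    proof
      assume ne: "sponge (Al 1) A \<omega> \<noteq> {}"
      have "?dim \<omega> \<le> ereal Q"
      proof (rule ereal_le_epsilon2)
        fix d :: real assume "d > 0"
        then obtain r where "1 / real (Suc r) < d / 2" using nat_approx_posE[of "d / 2"] by auto
        then have "ereal (Q + 2 / real (Suc r)) \<le> ereal Q + ereal d" by (simp add: field_simps)
        then show "?dim \<omega> \<le> ereal Q + ereal d" using elim ne by (meson order_trans)
      qed
      also have "\<dots> \<le> pressure Al p \<gamma> k \<Omega> A0 i \<theta>" by fact
      finally show "?dim \<omega> \<le> pressure Al p \<gamma> k \<Omega> A0 i \<theta>" .
    qed
  qed
qed

end

theorem theorem4p10: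
  fixes k :: nat
    and Al :: "nat \<Rightarrow> 'a set"
    and p :: "nat \<Rightarrow> 'a \<Rightarrow> 'a"
    and \<gamma> :: "nat \<Rightarrow> real"
    and \<Omega> :: "'w measure"
    and A0 :: "'w \<Rightarrow> 'a set"
    and A :: "'a list \<Rightarrow> 'w \<Rightarrow> 'a set"
  assumes k: "k \<ge> 2"
    and alphabets: "\<And>i. 1 \<le> i \<Longrightarrow> i \<le> k \<Longrightarrow> finite (Al i) \<and> card (Al i) \<ge> 2"
    and factor_maps: "\<And>i. 1 \<le> i \<Longrightarrow> i \<le> k - 1 \<Longrightarrow> p i ` Al i = Al (i + 1)"
    and gamma_pos: "\<And>i. 1 \<le> i \<Longrightarrow> i \<le> k \<Longrightarrow> \<gamma> i > 0"
    and prob: "prob_space \<Omega>"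
    and A0: "A0 \<in> measurable \<Omega> (count_space (Pow (Al 1)))"
    and mean: "(\<integral>\<omega>. real (card (A0 \<omega>)) \<partial>\<Omega>) > 1"
    and indep: "prob_space.indep_vars \<Omega> (\<lambda>_. count_space (Pow (Al 1))) A (lists (Al 1))"
    and copies: "\<And>u. u \<in> lists (Al 1) \<Longrightarrow>
      distr \<Omega> (count_space (Pow (Al 1))) (A u) = distr \<Omega> (count_space (Pow (Al 1))) A0"
    and reduced: "card (reduced_alphabet Al p \<Omega> A0 k) \<ge> 2"
  shows "AE \<omega> in \<Omega>. sponge (Al 1) A \<omega> \<noteq> {} \<longrightarrow>
    hausdorff_dim (space (shift_space (Al 1))) (sponge_dist p \<gamma> k) (sponge (Al 1) A \<omega>)
      \<le> Inf {pressure Al p \<gamma> k \<Omega> A0 i \<theta> | i \<theta>. 2 \<le> i \<and> i \<le> k \<and> theta_min \<gamma> i \<le> \<theta> \<and> \<theta> \<le> 1}"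
proof -
  interpret prob_space \<Omega> by (rule prob)
  interpret random_sponge \<Omega> k Al p \<gamma> A0 A
  proof
    show "reduced_alphabet Al p \<Omega> A0 k \<noteq> {}" using reduced by auto
  qed (use assms in auto)
  let ?R = "{pressure Al p \<gamma> k \<Omega> A0 i \<theta> | i \<theta>. 2 \<le> i \<and> i \<le> k \<and> theta_min \<gamma> i \<le> \<theta> \<and> \<theta> \<le> 1}"
  let ?dim = "\<lambda>\<omega>. hausdorff_dim (space (shift_space (Al 1))) (sponge_dist p \<gamma> k) (sponge (Al 1) A \<omega>)"
  show ?thesis
  proof (cases "?R = {}")
    case False
    \<comment> \<open>The infimum runs over uncountably many \<open>\<theta>\<close>; a sequence
      with the same infimum leaves only countably many null sets to unite.\<close>
    from Inf_countable_INF[OF this] obtain f :: "nat \<Rightarrow> ereal"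
      where f: "range f \<subseteq> ?R" "Inf ?R = (INF r. f r)" by blast
    have "AE \<omega> in \<Omega>. sponge (Al 1) A \<omega> \<noteq> {} \<longrightarrow> ?dim \<omega> \<le> f r" for r
    proof -
      have "f r \<in> ?R" using f(1) by blast
      then obtain i \<theta> where "f r = pressure Al p \<gamma> k \<Omega> A0 i \<theta>"
        "2 \<le> i" "i \<le> k" "theta_min \<gamma> i \<le> \<theta>" "\<theta> \<le> 1" by blast
      then show ?thesis using AE_dim_le_pressure by simp
    qed
    then have "AE \<omega> in \<Omega>. \<forall>r. sponge (Al 1) A \<omega> \<noteq> {} \<longrightarrow> ?dim \<omega> \<le> f r"
      unfolding AE_all_countable by blast
    then show ?thesis
      unfolding f(2) by eventually_elim (auto intro: INF_greatest)
  qed (simp only: Inf_empty top_greatest, simp)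
qed

end
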